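(* Let $\alpha,\beta,b,\lambda>0$ and $q=\alpha+\beta$. Let $\pi_0$ be the density of $\Gamma(\lambda,q)$, i.e. $\pi_0(x)\propto x^{q-1}\lambda^qe^{-\lambda x}$, $x>0$, and let $\tilde\pi_0$ be a probability density on $(0,\infty)$ such that $h_0:=\tilde\pi_0/\pi_0$ is Lipschitz continuous and $h_0\ge H$ for some constant $H>0$. Let $(X_n)_{n\ge 0}$, $(Y_n)_{n\ge1}$ be the hidden Markov model $X_n=bX_{n-1}W_n$, $Y_n=X_n^{-1}G_n$ with (true) initial distribution $X_0\sim\tilde\pi_0$, and let $\pi_n^{y_{1:n}}$ and $\tilde\pi_n^{y_{1:n}}$ be the optimal filters with respect to the initial conditions $\pi_0$ and $\tilde\pi_0$, respectively. Then: (i) For all $n\in\mathbb N$ and $y_{1:n}\in(0,\infty)^n$, with $\lambda_n=b^{-n}\lambda+\sum_{j=1}^nb^{j-n}y_j$, $$\|\pi_n^{y_{1:n}}-\tilde\pi_n^{y_{1:n}}\|_{var}\le\frac{\sqrt{2q}\,\|h_0\|_{Lip}}{2H}\,(b^n\lambda_n)^{-1}.$$ (ii) For every $\delta$ with $0<\delta<E(W_1^\beta)^{-1/\beta}$, almost surely with respect to the observations, $\|\pi_n^{Y_{1:n}}-\tilde\pi_n^{Y_{1:n}}\|_{var}=\mathcal O(\delta^{-n})$ as $n\to\infty$. (iii) For every $p$ with $0<p<\beta$, $$E\left(\|\pi_n^{Y_{1:n}}-\tilde\pi_n^{Y_{1:n}}\|_{var}^p\right)=\mathcal O(\rho^n),\quad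 n\to\infty,\qquad\text{with }\ \rho=E(W_1^p)=\frac{\mathrm B(\alpha+p,\beta)}{\mathrm B(\alpha,\beta)} .$$
   Context: Hidden Markov model: $X_n=bX_{n-1}W_n$, $Y_n=X_n^{-1}G_n$, $n\in\mathbb N=\{1,2,\dots\}$, where the $W_n$ are i.i.d. $\mathrm{Beta}(\alpha,\beta)$-distributed, the $G_n$ are i.i.d. $\Gamma(1,\beta)$-distributed, and $X_0>0$, $(W_n)_n$, $(G_n)_n$ are independent. Here $\Gamma(\lambda,r)$ denotes the Gamma distribution with rate $\lambda$ and shape $r$, with density $\frac{\lambda^r}{\Gamma(r)}x^{r-1}e^{-\lambda x}$ on $(0,\infty)$, and $\mathrm B$ is the Beta function. The transition density of the signal is $p(x,y)=\frac{(bx)^{1-q}}{\mathrm{B}(\alpha,\beta)}y^{\alpha-1}(bx-y)^{\beta-1}\mathbf 1_{[0,bx]}(y)$, and the conditional density of $Y_n$ given $X_n=x$ is $g(x,y)=\frac{x^\beta}{\Gamma(\beta)}y^{\beta-1}e^{-xy}$, $y>0$. Optimal filter: given an initial density $\pi_0$ and observations $y_{1:n}=(y_1,\dots,y_n)\in(0,\infty)^n$, $\pi_n^{y_{1:n}}$ (the conditional distribution of $X_n$ given $Y_{1:n}=y_{1:n}$ when $X_0\sim\pi_0$) is the probability density defined by $\pi_0^{y_{1:0}}=\pi_0$ and $$\pi_{n+1}^{y_{1:n+1}}(x)=\frac{g(x,y_{n+1})\int_0^\infty p(s,x)\pi_n^{y_{1:n}}(s)\,ds}{\int_0^\infty g(z,y_{n+1})\int_0^\infty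 p(s,z)\pi_n^{y_{1:n}}(s)\,ds\,dz},\qquad x>0;$$ $\tilde\pi_n^{y_{1:n}}$ is defined in the same way starting from $\tilde\pi_0$. $\|f\|_{Lip}$ is the Lipschitz constant of $f$. $\|\mu-\nu\|_{var}=\sup_A|\mu(A)-\nu(A)|$ (so it is bounded by 1). *)

theory Defs
  imports "HOL-Probability.Probability" "HOL-Library.Landau_Symbols"
begin

definition gamma_density :: "real \<Rightarrow> real \<Rightarrow> real \<Rightarrow> real" where
  "gamma_density lam r x =
     indicator {0<..} x * (lam powr r / Gamma r * x powr (r - 1) * exp (- lam * x))"

definition beta_density :: "real \<Rightarrow> real \<Rightarrow> real \<Rightarrow> real" where
  "beta_density a c x =
     indicator {0<..<1} x * (x powr (a - 1) * (1 - x) powr (c - 1) / Beta a c)"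

text \<open>
  Densities on the half-line are total functions on the reals of which only the values at
  positive arguments matter; accordingly every integral below is restricted to the positive reals.
\<close>

definition halfline_prob_density :: "(real \<Rightarrow> real) \<Rightarrow> bool" where
  "halfline_prob_density f \<longleftrightarrow>
     set_borel_measurable borel {0<..} f \<and> (\<forall>x>0. 0 \<le> f x) \<and>
     (\<integral>\<^sup>+x. ennreal (indicator {0<..} x * f x) \<partial>lborel) = 1"

definition halfline_measure :: "(real \<Rightarrow> real) \<Rightarrow> real measure" where
  "halfline_measure f = density lborel (\<lambda>x. ennreal (indicator {0<..} x * f x))"

definition tv_dist :: "'a measure \<Rightarrow> 'a measure \<Rightarrow> real" where
  "tv_dist \<mu> \<nu> = (SUP A\<in>sets \<mu>. \<bar>measure \<mu> A - measure \<nu> A\<bar>)"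

definition lip_const :: "('a::metric_space) set \<Rightarrow> ('a \<Rightarrow> 'b::metric_space) \<Rightarrow> real" where
  "lip_const S f = Inf {L. L-lipschitz_on S f}"

definition trans_density :: "real \<Rightarrow> real \<Rightarrow> real \<Rightarrow> real \<Rightarrow> real \<Rightarrow> real" where
  "trans_density \<alpha> \<beta> b x y =
     (b * x) powr (1 - (\<alpha> + \<beta>)) / Beta \<alpha> \<beta> * y powr (\<alpha> - 1) * (b * x - y) powr (\<beta> - 1)
     * indicator {0..b * x} y"

definition obs_density :: "real \<Rightarrow> real \<Rightarrow> real \<Rightarrow> real" where
  "obs_density \<beta> x y =
     indicator {0<..} y * (x powr \<beta> / Gamma \<beta> * y powr (\<beta> - 1) * exp (- x * y))"

text \<open>
  The observations are a sequence \<open>y\<close>; the filter at time \<open>n\<close> uses \<open>y 1, \<dots>, y n\<close> only.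
\<close>

primrec opt_filter ::
  "real \<Rightarrow> real \<Rightarrow> real \<Rightarrow> (real \<Rightarrow> real) \<Rightarrow> (nat \<Rightarrow> real) \<Rightarrow> nat \<Rightarrow> real \<Rightarrow> real" where
  "opt_filter \<alpha> \<beta> b f y 0 = f"
| "opt_filter \<alpha> \<beta> b f y (Suc n) = (\<lambda>x.
     obs_density \<beta> x (y (Suc n)) *
       (LINT s:{0<..}|lborel. trans_density \<alpha> \<beta> b s x * opt_filter \<alpha> \<beta> b f y n s) /
     (LINT z:{0<..}|lborel. obs_density \<beta> z (y (Suc n)) *
       (LINT s:{0<..}|lborel. trans_density \<alpha> \<beta> b s z * opt_filter \<alpha> \<beta> b f y n s)))"

definition filter_dist ::
  "real \<Rightarrow> real \<Rightarrow> real \<Rightarrow> (real \<Rightarrow> real) \<Rightarrow> (real \<Rightarrow> real) \<Rightarrow> (nat \<Rightarrow> real) \<Rightarrow> nat \<Rightarrow> real" where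
  "filter_dist \<alpha> \<beta> b f f' y n =
     tv_dist (halfline_measure (opt_filter \<alpha> \<beta> b f y n))
             (halfline_measure (opt_filter \<alpha> \<beta> b f' y n))"

datatype source = Init | SignalNoise nat | ObsNoise nat

fun sources ::
  "(nat \<Rightarrow> 'a \<Rightarrow> real) \<Rightarrow> (nat \<Rightarrow> 'a \<Rightarrow> real) \<Rightarrow> (nat \<Rightarrow> 'a \<Rightarrow> real) \<Rightarrow> source \<Rightarrow> 'a \<Rightarrow> real" where
  "sources X W G Init = X 0"
| "sources X W G (SignalNoise n) = W n"
| "sources X W G (ObsNoise n) = G n"

text \<open>
  The initial density \<open>f\<close> lives on the positive reals, so \<open>X 0\<close> is almost surely positive.
  The noises \<open>W\<close>, \<open>G\<close> and the observations \<open>Y\<close> are indexed from 1; their values at index 0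
  are unconstrained and unused.
\<close>

locale hidden_markov_model = prob_space M
  for M :: "'a measure" +
  fixes \<alpha> \<beta> b :: real and f :: "real \<Rightarrow> real" and X Y W G :: "nat \<Rightarrow> 'a \<Rightarrow> real"
  assumes init: "distributed M lborel (X 0) (\<lambda>x. ennreal (indicator {0<..} x * f x))"
    and signal_noise: "\<And>n. n \<ge> 1 \<Longrightarrow> distributed M lborel (W n) (\<lambda>x. ennreal (beta_density \<alpha> \<beta> x))"
    and obs_noise: "\<And>n. n \<ge> 1 \<Longrightarrow> distributed M lborel (G n) (\<lambda>x. ennreal (gamma_density 1 \<beta> x))"
    and indep: "indep_vars (\<lambda>_. borel) (sources X W G)
                  ({Init} \<union> SignalNoise ` {1..} \<union> ObsNoise ` {1..})"
    and signal: "\<And>n \<omega>. n \<ge> 1 \<Longrightarrow> \<omega> \<in> space M \<Longrightarrow> X n \<omega> = b * X (n - 1) \<omega> * W n \<omega>"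
    and observation: "\<And>n \<omega>. n \<ge> 1 \<Longrightarrow> \<omega> \<in> space M \<Longrightarrow> Y n \<omega> = inverse (X n \<omega>) * G n \<omega>"

end

theory Submission
  imports Defs
begin

text \<open>
  The Gamma densities are conjugate: \<open>p(s,x)\<close> times the \<open>\<Gamma>(l,\<alpha>+\<beta>)\<close> density at \<open>s\<close>
  factorises into the \<open>\<Gamma>(l/b,\<alpha>)\<close> density at \<open>x\<close> and the \<open>\<Gamma>(l,\<beta>)\<close> density at \<open>s - x/b\<close>, and
  weighting by \<open>g(x,y)\<close> turns \<open>\<Gamma>(l/b,\<alpha>)\<close> into \<open>\<Gamma>(l/b+y,\<alpha>+\<beta>)\<close>. Hence the filter started at
  \<open>\<pi>\<^sub>0 h\<close> is \<open>\<Gamma>(\<lambda>\<^sub>n,q)\<close> reweighted by a function \<open>h\<^sub>n\<close>, where one step averages \<open>h\<^sub>n\<close> at \<open>x/b\<close> plus an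
  independent Gamma variable. This divides the Lipschitz constant by \<open>b\<close> and preserves the lower bound,
  while the standard deviation \<open>\<surd>q/\<lambda>\<^sub>n\<close> of \<open>\<Gamma>(\<lambda>\<^sub>n,q)\<close> controls the \<open>L\<^sup>1\<close> distance of \<open>h\<^sub>n\<close> from its mean.

  Keeping only the last observation, \<open>b\<^sup>n \<lambda>\<^sub>n \<ge> b\<^sup>n Y\<^sub>n = G\<^sub>n / (X\<^sub>0 W\<^sub>1 \<cdots> W\<^sub>n)\<close>, and independence gives (iii).
  Part (ii) follows from (iii) with \<open>p = \<beta>/2\<close> by a Borel--Cantelli argument, since
  \<open>E(W\<^bsup>\<beta>/2\<^esup>)\<^sup>2 \<le> E(W\<^bsup>\<beta>\<^esup>)\<close>.
\<close>

section \<open>Gamma and Beta densities\<close>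

lemma gamma_density_measurable [measurable]: "gamma_density l r \<in> borel_measurable borel"
  unfolding gamma_density_def[abs_def] by measurable

lemma gamma_density_nonneg: "l > 0 \<Longrightarrow> r > 0 \<Longrightarrow> 0 \<le> gamma_density l r x"
  by (auto simp: gamma_density_def indicator_def Gamma_real_nonneg)

lemma nn_integral_gamma_density:
  assumes l: "l > 0" and r: "r > 0"
  shows "(\<integral>\<^sup>+x. ennreal (gamma_density l r x) \<partial>lborel) = 1"
proof -
  have G: "Gamma r > 0" using r by (rule Gamma_real_pos)
  let ?f = "\<lambda>t::real. ennreal (indicator {0..} t * t powr (r - 1) / exp t)"
  have "ennreal (Gamma r) = ennreal l * (\<integral>\<^sup>+x. ?f (0 + l * x) \<partial>lborel)"
    unfolding Gamma_conv_nn_integral_real[OF r]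
    by (subst nn_integral_real_affine[of ?f l 0]) (use l in auto)
  also have "\<dots> = (\<integral>\<^sup>+x. ennreal l * ?f (0 + l * x) \<partial>lborel)"
    by (rule nn_integral_cmult[symmetric]) simp
  also have "\<dots> = (\<integral>\<^sup>+x. ennreal (Gamma r) * ennreal (gamma_density l r x) \<partial>lborel)"
  proof (rule nn_integral_cong)
    fix x :: real
    have "l * (l * x) powr (r - 1) = l powr r * x powr (r - 1)" if "x > 0"
      using that l by (simp add: powr_mult powr_diff)
    \<comment> \<open>Euler's integral includes the endpoint and the Gamma density does not. At
      \<open>x = 0\<close> both sides vanish all the same, because
      \<open>0 powr (r - 1) = 0\<close>.\<close>
    then have "l * (indicator {0..} (0 + l * x) * (0 + l * x) powr (r - 1) / exp (0 + l * x))
        = Gamma r * gamma_density l r x"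
      using G l by (cases "x > 0"; cases "x = 0")
        (auto simp: gamma_density_def indicator_def zero_le_mult_iff exp_minus field_simps)
    then show "ennreal l * ?f (0 + l * x) = ennreal (Gamma r) * ennreal (gamma_density l r x)"
      using l G by (simp add: ennreal_mult'[symmetric] del: add_0)
  qed
  also have "\<dots> = ennreal (Gamma r) * (\<integral>\<^sup>+x. ennreal (gamma_density l r x) \<partial>lborel)"
    by (rule nn_integral_cmult) simp
  finally have "ennreal (Gamma r) * (\<integral>\<^sup>+x. ennreal (gamma_density l r x) \<partial>lborel)
      = ennreal (Gamma r) * 1" by simp
  then show ?thesis
    using G by (subst (asm) ennreal_mult_cancel_left) auto
qed

lemma has_bochner_integral_gamma_density:
  assumes "l > 0" and "r > 0"
  shows "has_bochner_integral lborel (gamma_density l r) 1"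
  by (rule has_bochner_integral_nn_integral)
     (use assms in \<open>auto simp: nn_integral_gamma_density gamma_density_nonneg\<close>)

text \<open>A power weight only shifts the shape, so each moment is a ratio of normalising
  constants. The exponent may be negative as long as the shifted shape stays positive, which later
  gives the moments of 1/G.\<close>

lemma gamma_density_times_powr:
  assumes "l > 0" and "r > 0" and "r + p > 0"
  shows "gamma_density l r x * x powr p =
    Gamma (r + p) / (Gamma r * l powr p) * gamma_density l (r + p) x"
proof (cases "x > 0")
  case True
  have "Gamma r > 0" "Gamma (r + p) > 0" using assms Gamma_real_pos by blast+
  moreover have "x powr (r + p - 1) = x powr (r - 1) * x powr p"
    by (simp flip: powr_add add: algebra_simps)
  ultimately show ?thesis
    using True assms by (simp add: gamma_density_def powr_add less_imp_neq[THEN not_sym])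
qed (simp add: gamma_density_def)

lemma gamma_density_moment:
  assumes "l > 0" and "r > 0" and "r + p > 0"
  shows "has_bochner_integral lborel (\<lambda>x. gamma_density l r x * x powr p)
    (Gamma (r + p) / (Gamma r * l powr p))"
  unfolding gamma_density_times_powr[OF assms]
  using has_bochner_integral_mult_right[OF has_bochner_integral_gamma_density[OF assms(1,3)],
      of "Gamma (r + p) / (Gamma r * l powr p)"] by simp

lemma
  assumes l: "l > 0" and r: "r > 0"
  shows gamma_density_mean: "has_bochner_integral lborel (\<lambda>x. gamma_density l r x * x) (r / l)"
    and gamma_density_second_moment:
      "has_bochner_integral lborel (\<lambda>x. gamma_density l r x * x\<^sup>2) (r * (r + 1) / l\<^sup>2)"
proof -
  have G: "Gamma r > 0" "Gamma (r + 1) = r * Gamma r" "Gamma (r + 2) = (r + 1) * (r * Gamma r)"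
    using r Gamma_plus1[of r] Gamma_plus1[of "r + 1"] Gamma_real_pos[OF r]
    by (auto simp: nonpos_Ints_def add.assoc)
  have "(\<lambda>x. gamma_density l r x * x) = (\<lambda>x. gamma_density l r x * x powr 1)"
    by (auto simp: gamma_density_def indicator_def)
  then show "has_bochner_integral lborel (\<lambda>x. gamma_density l r x * x) (r / l)"
    using gamma_density_moment[of l r 1] l r G by simp
  have "(\<lambda>x. gamma_density l r x * x\<^sup>2) = (\<lambda>x. gamma_density l r x * x powr 2)"
    by (auto simp: gamma_density_def indicator_def)
  then show "has_bochner_integral lborel (\<lambda>x. gamma_density l r x * x\<^sup>2) (r * (r + 1) / l\<^sup>2)"
    using gamma_density_moment[of l r 2] l r G by (simp add: mult.commute)
qed

lemma Beta_real_pos: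
  fixes a c :: real
  assumes "a > 0" and "c > 0"
  shows "Beta a c > 0"
proof -
  have "Gamma a > 0" "Gamma c > 0" "Gamma (a + c) > 0" using assms by (auto simp: Gamma_real_pos)
  then show ?thesis by (simp add: Beta_def)
qed

lemma beta_density_moment:
  assumes a: "a > 0" and c: "c > 0" and p: "a + p > 0"
  shows "has_bochner_integral lborel (\<lambda>x. beta_density a c x * x powr p) (Beta (a + p) c / Beta a c)"
proof -
  have B: "Beta a c > 0" "Beta (a + p) c > 0"
    using assms by (auto intro: Beta_real_pos)
  have eq: "beta_density a c x * x powr p =
      indicator {0<..<1} x * (x powr (a + p - 1) * (1 - x) powr (c - 1)) / Beta a c" for x
    by (auto simp: beta_density_def indicator_def algebra_simps simp flip: powr_add)
  have "(\<integral>\<^sup>+x. ennreal (indicator {0<..<1} x * (x powr (a + p - 1) * (1 - x) powr (c - 1))) \<partial>lborel)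
      = ennreal (Beta (a + p) c)"
    using has_integral_Beta_real[OF p c]
    by (intro nn_integral_has_integral_lebesgue) (auto simp: has_integral_Icc_iff_Ioo)
  then have "has_bochner_integral lborel
      (\<lambda>x. indicator {0<..<1} x * (x powr (a + p - 1) * (1 - x) powr (c - 1))) (Beta (a + p) c)"
    using B by (intro has_bochner_integral_nn_integral) auto
  from has_bochner_integral_divide[OF this, of "Beta a c"] show ?thesis
    unfolding eq using B by simp
qed

text \<open>Beta-Gamma algebra: if s is Gamma(l, \<alpha> + \<beta>) and W is an independent
  Beta(\<alpha>, \<beta>) variable, then x = b s W and v = s (1 - W) are independent Gamma
  variables. Both sides are their joint density; the change from s to v = s - x/b has Jacobian
  1.\<close>

lemma trans_density_times_gamma_density:
  assumes \<alpha>: "\<alpha> > 0" and \<beta>: "\<beta> > 0" and b: "b > 0" and l: "l > 0" and s: "s > 0" and x: "x > 0"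
  shows "trans_density \<alpha> \<beta> b s x * gamma_density l (\<alpha> + \<beta>) s =
    gamma_density (l / b) \<alpha> x * gamma_density l \<beta> (s - x / b)"
proof (cases "s - x / b > 0")
  case True
  define v where "v = s - x / b"
  have v: "v > 0" and bv: "b * s - x = b * v" and sv: "s = x / b + v"
    using True b by (simp_all add: v_def field_simps)
  have le: "x \<le> b * s" using bv mult_pos_pos[OF b v] by linarith
  have G: "Gamma \<alpha> > 0" "Gamma \<beta> > 0" "Gamma (\<alpha> + \<beta>) > 0"
    using \<alpha> \<beta> by (auto simp: Gamma_real_pos)
  have e1: "(b * s) powr (1 - (\<alpha> + \<beta>)) = b powr (1 - (\<alpha> + \<beta>)) * s powr (1 - (\<alpha> + \<beta>))"
    using b s by (simp add: powr_mult)
  have e2: "s powr (1 - (\<alpha> + \<beta>)) * s powr (\<alpha> + \<beta> - 1) = 1"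
    using s by (simp flip: powr_add)
  have e3: "(b * v) powr (\<beta> - 1) = b powr (\<beta> - 1) * v powr (\<beta> - 1)"
    using b v by (simp add: powr_mult)
  have "b powr (1 - (\<alpha> + \<beta>)) * b powr (\<beta> - 1) = b powr (- \<alpha>)"
    by (simp flip: powr_add)
  then have e4: "b powr (1 - (\<alpha> + \<beta>)) * b powr (\<beta> - 1) = inverse (b powr \<alpha>)"
    by (simp add: powr_minus)
  have e5: "exp (- l * s) = exp (- (l / b) * x) * exp (- l * v)"
    unfolding sv by (simp flip: exp_add add: algebra_simps)
  have e6: "(l / b) powr \<alpha> = l powr \<alpha> * inverse (b powr \<alpha>)"
    using l b by (simp add: powr_divide divide_inverse[of "l powr \<alpha>"])
  have "trans_density \<alpha> \<beta> b s x * gamma_density l (\<alpha> + \<beta>) s =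
      (b powr (1 - (\<alpha> + \<beta>)) * b powr (\<beta> - 1)) * (s powr (1 - (\<alpha> + \<beta>)) * s powr (\<alpha> + \<beta> - 1))
      * (Gamma (\<alpha> + \<beta>) / (Gamma \<alpha> * Gamma \<beta>)) * x powr (\<alpha> - 1) * v powr (\<beta> - 1)
      * (l powr \<alpha> * l powr \<beta> / Gamma (\<alpha> + \<beta>)) * exp (- l * s)"
    using x s le unfolding trans_density_def gamma_density_def bv e1 e3
    by (simp add: Beta_def powr_add)
  also have "\<dots> = (l powr \<alpha> * inverse (b powr \<alpha>) / Gamma \<alpha> * x powr (\<alpha> - 1) * exp (- (l / b) * x))
      * (l powr \<beta> / Gamma \<beta> * v powr (\<beta> - 1) * exp (- l * v))"
    unfolding e2 e4 e5 using G by simp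
  also have "\<dots> = gamma_density (l / b) \<alpha> x * gamma_density l \<beta> v"
    unfolding gamma_density_def e6 using x v by simp
  finally show ?thesis unfolding v_def .
next
  case False
  then have "b * s - x \<le> 0" using b by (simp add: field_simps)
  \<comment> \<open>At the edge \<open>b * s = x\<close> the indicator equals 1, but the factor
    \<open>0 powr (\<beta> - 1)\<close> is 0 by convention, whatever the sign of the
    exponent.\<close>
  then have "trans_density \<alpha> \<beta> b s x = 0"
    by (auto simp: trans_density_def indicator_def)
  then show ?thesis using False by (simp add: gamma_density_def)
qed

text \<open>As a function of x the likelihood is a constant times a power and an exponential, so it
  adds \<beta> to the shape and y to the rate. Only the sign of \<open>C\<close> is exported, since
  \<open>C\<close> cancels in the normalised filter.\<close>

lemma obs_density_times_gamma_density:
  assumes \<alpha>: "\<alpha> > 0" and \<beta>: "\<beta> > 0" and l: "l > 0" and y: "y > 0"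
  obtains C where "C > 0"
    and "\<And>x. obs_density \<beta> x y * gamma_density l \<alpha> x = C * gamma_density (l + y) (\<alpha> + \<beta>) x"
proof
  define C where "C = l powr \<alpha> * y powr (\<beta> - 1) * Gamma (\<alpha> + \<beta>) /
    (Gamma \<alpha> * Gamma \<beta> * (l + y) powr (\<alpha> + \<beta>))"
  have G: "Gamma \<alpha> > 0" "Gamma \<beta> > 0" "Gamma (\<alpha> + \<beta>) > 0"
    using \<alpha> \<beta> by (auto simp: Gamma_real_pos)
  then show "C > 0" using assms by (simp add: C_def)
  show "obs_density \<beta> x y * gamma_density l \<alpha> x = C * gamma_density (l + y) (\<alpha> + \<beta>) x" for x
  proof (cases "x > 0")
    case True
    have "x powr (\<alpha> + \<beta> - 1) = x powr \<beta> * x powr (\<alpha> - 1)"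
      "exp (- (l + y) * x) = exp (- x * y) * exp (- l * x)"
      by (simp_all flip: powr_add exp_add add: algebra_simps)
    moreover have "(l + y) powr (\<alpha> + \<beta>) > 0" using l y by simp
    ultimately show ?thesis
      using True y G by (simp add: obs_density_def gamma_density_def C_def mult_ac)
  qed (simp add: gamma_density_def)
qed

text \<open>A Lipschitz function grows at most linearly, and the Gamma law has a finite
  mean.\<close>

lemma integrable_gamma_density_lipschitz:
  fixes h :: "real \<Rightarrow> real"
  assumes l: "l > 0" and r: "r > 0" and h: "L-lipschitz_on UNIV h"
  shows "integrable lborel (\<lambda>x. gamma_density l r x * h x)"
proof (rule Bochner_Integration.integrable_bound)
  show "integrable lborel (\<lambda>x. gamma_density l r x * \<bar>h 0\<bar> + L * (gamma_density l r x * x))"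
    using has_bochner_integral_gamma_density[OF l r] gamma_density_mean[OF l r]
    by (intro Bochner_Integration.integrable_add integrable_mult_left integrable_mult_right)
       (auto dest: integrable.intros)
  show "AE x in lborel. norm (gamma_density l r x * h x)
      \<le> norm (gamma_density l r x * \<bar>h 0\<bar> + L * (gamma_density l r x * x))"
  proof (rule AE_I2)
    fix x
    have g: "gamma_density l r x \<ge> 0" "gamma_density l r x * \<bar>x\<bar> = gamma_density l r x * x"
      using l r by (auto simp: gamma_density_nonneg) (auto simp: gamma_density_def indicator_def)
    have "\<bar>h x - h 0\<bar> \<le> L * \<bar>x\<bar>"
      using lipschitz_onD[OF h, of x 0] by (simp add: dist_real_def)
    then have "\<bar>h x\<bar> \<le> \<bar>h 0\<bar> + L * \<bar>x\<bar>" by linarith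
    from mult_left_mono[OF this g(1)]
    have "gamma_density l r x * \<bar>h x\<bar> \<le> gamma_density l r x * (\<bar>h 0\<bar> + L * \<bar>x\<bar>)" .
    also have "\<dots> = gamma_density l r x * \<bar>h 0\<bar> + L * (gamma_density l r x * x)"
      by (simp only: distrib_left mult.left_commute[of _ L] g(2))
    finally show "norm (gamma_density l r x * h x)
      \<le> norm (gamma_density l r x * \<bar>h 0\<bar> + L * (gamma_density l r x * x))"
      using g(1) by (simp add: abs_mult)
  qed
  show "(\<lambda>x. gamma_density l r x * h x) \<in> borel_measurable lborel"
    using borel_measurable_continuous_onI[OF lipschitz_on_continuous_on[OF h]] by simp
qed

text \<open>\<open>T\<close> is the effect of one prediction step on the reweighting function.
  Averaging over a probability law preserves Lipschitz constants and lower bounds, and the dilation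
  x/b contributes the factor 1/b.\<close>

lemma
  fixes h :: "real \<Rightarrow> real" and b :: real
  assumes l: "l > 0" and r: "r > 0" and h: "L-lipschitz_on UNIV h"
    and T_def: "\<And>x. T x = (\<integral>v. gamma_density l r v * h (x / b + v) \<partial>lborel)"
  shows gamma_average_lipschitz: "b > 0 \<Longrightarrow> (L / b)-lipschitz_on UNIV T"
    and gamma_average_ge: "(\<And>x. H \<le> h x) \<Longrightarrow> H \<le> T x"
proof -
  have g0: "gamma_density l r v \<ge> 0" for v using l r by (rule gamma_density_nonneg)
  have g1: "integrable lborel (gamma_density l r)" "integral\<^sup>L lborel (gamma_density l r) = 1"
    using has_bochner_integral_gamma_density[OF l r] by (auto simp: has_bochner_integral_iff)
  have int: "integrable lborel (\<lambda>v. gamma_density l r v * h (c + v))" for c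
  proof (rule integrable_gamma_density_lipschitz[OF l r])
    have "dist (h (c + v)) (h (c + w)) \<le> L * dist v w" for v w
      using lipschitz_onD[OF h, of "c + v" "c + w"] by simp
    then show "L-lipschitz_on UNIV (\<lambda>v. h (c + v))"
      using lipschitz_on_nonneg[OF h] by (intro lipschitz_onI) auto
  qed
  show "(L / b)-lipschitz_on UNIV T" if b: "b > 0"
  proof (rule lipschitz_onI)
    fix x y
    have "\<bar>T x - T y\<bar> = \<bar>\<integral>v. gamma_density l r v * (h (x / b + v) - h (y / b + v)) \<partial>lborel\<bar>"
      unfolding T_def by (simp add: right_diff_distrib Bochner_Integration.integral_diff[OF int int])
    also have "\<dots> \<le> (\<integral>v. \<bar>gamma_density l r v * (h (x / b + v) - h (y / b + v))\<bar> \<partial>lborel)"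
      by (rule integral_abs_bound)
    also have "\<dots> \<le> (\<integral>v. gamma_density l r v * (L * \<bar>x / b - y / b\<bar>) \<partial>lborel)"
    proof (rule integral_mono)
      show "integrable lborel (\<lambda>v. \<bar>gamma_density l r v * (h (x / b + v) - h (y / b + v))\<bar>)"
        unfolding right_diff_distrib using int by (intro integrable_abs Bochner_Integration.integrable_diff)
      show "integrable lborel (\<lambda>v. gamma_density l r v * (L * \<bar>x / b - y / b\<bar>))"
        using g1 by simp
      fix v
      have "\<bar>h (x / b + v) - h (y / b + v)\<bar> \<le> L * \<bar>x / b - y / b\<bar>"
        using lipschitz_onD[OF h, of "x / b + v" "y / b + v"] by (simp add: dist_real_def)
      then show "\<bar>gamma_density l r v * (h (x / b + v) - h (y / b + v))\<bar>
          \<le> gamma_density l r v * (L * \<bar>x / b - y / b\<bar>)"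
        using g0[of v] by (simp add: abs_mult mult_left_mono)
    qed
    also have "\<dots> = L / b * \<bar>x - y\<bar>"
      using g1 b by (simp flip: diff_divide_distrib)
    finally show "dist (T x) (T y) \<le> L / b * dist x y" by (simp add: dist_real_def)
  qed (use lipschitz_on_nonneg[OF h] that in simp)
  show "H \<le> T x" if "\<And>x. H \<le> h x"
  proof -
    have "H = (\<integral>v. gamma_density l r v * H \<partial>lborel)" using g1 by simp
    also have "\<dots> \<le> T x"
      unfolding T_def using g1 int that g0 by (intro integral_mono mult_left_mono) auto
    finally show ?thesis .
  qed
qed

section \<open>The filter as a reweighted Gamma density\<close>

text \<open>
  Only the ratio \<open>K\<close> of Lipschitz constant to lower bound is recorded, because it is unaffected by
  the normalisation of the filter; \<open>K = 0\<close> forces \<open>f\<close> to be the Gamma density itself.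
\<close>

definition gamma_tilt :: "real \<Rightarrow> real \<Rightarrow> real \<Rightarrow> (real \<Rightarrow> real) \<Rightarrow> bool" where
  "gamma_tilt l r K f \<longleftrightarrow> (\<exists>h H. H > 0 \<and> (\<forall>x. H \<le> h x) \<and> (K * H)-lipschitz_on UNIV h \<and>
     (\<integral>x. gamma_density l r x * h x \<partial>lborel) = 1 \<and> (\<forall>x>0. f x = gamma_density l r x * h x))"

text \<open>By conjugacy the predicted density is Gamma(l/b, \<alpha>) times \<open>T\<close>, and
  the likelihood turns it into \<open>C\<close> times Gamma(l/b + y, \<alpha> + \<beta>) times
  \<open>T\<close>. Normalising replaces \<open>T\<close> by \<open>T / I\<close>, which scales the
  Lipschitz constant and the lower bound alike; their ratio changes only by the factor 1/b from
  averaging.\<close>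

lemma gamma_tilt_filter_step:
  assumes \<alpha>: "\<alpha> > 0" and \<beta>: "\<beta> > 0" and b: "b > 0" and l: "l > 0" and y: "y > 0"
    and tilt: "gamma_tilt l (\<alpha> + \<beta>) K f"
  shows "gamma_tilt (l / b + y) (\<alpha> + \<beta>) (K / b)
    (\<lambda>x. obs_density \<beta> x y * (LINT s:{0<..}|lborel. trans_density \<alpha> \<beta> b s x * f s) /
      (LINT z:{0<..}|lborel. obs_density \<beta> z y * (LINT s:{0<..}|lborel. trans_density \<alpha> \<beta> b s z * f s)))"
proof -
  obtain h H where H: "H > 0" and hH: "\<And>x. H \<le> h x" and hL: "(K * H)-lipschitz_on UNIV h"
    and f: "\<And>x. x > 0 \<Longrightarrow> f x = gamma_density l (\<alpha> + \<beta>) x * h x"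
    using tilt unfolding gamma_tilt_def by blast
  define N where "N z = (LINT s:{0<..}|lborel. trans_density \<alpha> \<beta> b s z * f s)" for z
  define T where "T z = (\<integral>v. gamma_density l \<beta> v * h (z / b + v) \<partial>lborel)" for z
  have N: "N z = gamma_density (l / b) \<alpha> z * T z" if z: "z > 0" for z
  proof -
    have "N z = (\<integral>s. gamma_density (l / b) \<alpha> z * (gamma_density l \<beta> (s - z / b) * h s) \<partial>lborel)"
      unfolding N_def set_lebesgue_integral_def
    proof (rule Bochner_Integration.integral_cong)
      fix s :: real
      show "indicator {0<..} s *\<^sub>R (trans_density \<alpha> \<beta> b s z * f s) =
          gamma_density (l / b) \<alpha> z * (gamma_density l \<beta> (s - z / b) * h s)"
      proof (cases "s > 0")
        case True
        then show ?thesis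
          using trans_density_times_gamma_density[OF \<alpha> \<beta> b l True z] by (simp add: f)
      next
        case False
        \<comment> \<open>For s <= 0 the shifted argument \<open>s - z / b\<close> is negative and
          the Gamma density vanishes there, so the integral over the half-line becomes one over the
          whole line.\<close>
        moreover have "z / b > 0" using z b by simp
        ultimately show ?thesis by (simp add: gamma_density_def)
      qed
    qed simp
    also have "\<dots> = gamma_density (l / b) \<alpha> z * (\<integral>s. gamma_density l \<beta> (s - z / b) * h s \<partial>lborel)"
      by simp
    also have "(\<integral>s. gamma_density l \<beta> (s - z / b) * h s \<partial>lborel) = T z"
      unfolding T_def by (subst lborel_integral_real_affine[of 1 _ "z / b"]) simp_all
    finally show ?thesis .
  qed
  have lb: "l / b > 0" using l b by simp
  then have l': "l / b + y > 0" using y by simp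
  have q: "\<alpha> + \<beta> > 0" using \<alpha> \<beta> by simp
  obtain C where C: "C > 0"
    and "\<And>x. obs_density \<beta> x y * gamma_density (l / b) \<alpha> x = C * gamma_density (l / b + y) (\<alpha> + \<beta>) x"
    using obs_density_times_gamma_density[OF \<alpha> \<beta> lb y] by blast
  then have num: "obs_density \<beta> z y * N z = C * (gamma_density (l / b + y) (\<alpha> + \<beta>) z * T z)"
    if "z > 0" for z
    unfolding N[OF that] mult.assoc[symmetric] by simp
  define I where "I = (\<integral>z. gamma_density (l / b + y) (\<alpha> + \<beta>) z * T z \<partial>lborel)"
  have "(LINT z:{0<..}|lborel. obs_density \<beta> z y * N z) =
      (\<integral>z. C * (gamma_density (l / b + y) (\<alpha> + \<beta>) z * T z) \<partial>lborel)"
    unfolding set_lebesgue_integral_def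
  proof (rule Bochner_Integration.integral_cong)
    fix z :: real
    show "indicator {0<..} z *\<^sub>R (obs_density \<beta> z y * N z) =
        C * (gamma_density (l / b + y) (\<alpha> + \<beta>) z * T z)"
      using num[of z] by (cases "z > 0") (simp_all add: gamma_density_def)
  qed simp
  then have den: "(LINT z:{0<..}|lborel. obs_density \<beta> z y * N z) = C * I" by (simp add: I_def)
  have TL: "(K * H / b)-lipschitz_on UNIV T"
    by (rule gamma_average_lipschitz[OF l \<beta> hL T_def b])
  have TH: "H \<le> T z" for z
    by (rule gamma_average_ge[OF l \<beta> hL T_def hH])
  have int: "integrable lborel (\<lambda>z. gamma_density (l / b + y) (\<alpha> + \<beta>) z * T z)"
    by (rule integrable_gamma_density_lipschitz[OF l' q TL])
  \<comment> \<open>The normaliser must not vanish: \<open>I\<close> is the mean of \<open>T\<close>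
    under a probability density, hence at least \<open>H\<close>.\<close>
  have "H = (\<integral>z. gamma_density (l / b + y) (\<alpha> + \<beta>) z * H \<partial>lborel)"
    using has_bochner_integral_gamma_density[OF l' q] by (simp add: has_bochner_integral_iff)
  also have "\<dots> \<le> I"
    unfolding I_def using int TH has_bochner_integral_gamma_density[OF l' q]
    by (intro integral_mono mult_left_mono gamma_density_nonneg l' q)
       (auto simp: has_bochner_integral_iff)
  finally have I: "I > 0" using H by simp
  show ?thesis
    unfolding gamma_tilt_def N_def[symmetric] den
  proof (intro exI conjI allI impI)
    show "H / I > 0" using H I by simp
    show "H / I \<le> T x / I" for x using TH I by (simp add: divide_right_mono)
    show "(K / b * (H / I))-lipschitz_on UNIV (\<lambda>x. T x / I)"
    proof (rule lipschitz_onI)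
      fix x y
      have "\<bar>T x - T y\<bar> \<le> K * H / b * \<bar>x - y\<bar>"
        using lipschitz_onD[OF TL, of x y] by (simp add: dist_real_def)
      then have "\<bar>T x - T y\<bar> / I \<le> K * H / b * \<bar>x - y\<bar> / I"
        using I by (intro divide_right_mono) auto
      then show "dist (T x / I) (T y / I) \<le> K / b * (H / I) * dist x y"
        using I by (simp add: dist_real_def flip: diff_divide_distrib)
    qed (use divide_nonneg_pos[OF lipschitz_on_nonneg[OF TL] I] in simp)
    show "(\<integral>x. gamma_density (l / b + y) (\<alpha> + \<beta>) x * (T x / I) \<partial>lborel) = 1"
      using I by (simp add: I_def)
    show "obs_density \<beta> x y * N x / (C * I) = gamma_density (l / b + y) (\<alpha> + \<beta>) x * (T x / I)"
      if "x > 0" for x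
      using num[OF that] C by simp
  qed
qed

text \<open>This is the rate \<lambda>_n of the theorem, in the recursive form in which the filter
  step produces it. After scaling by \<open>b ^ n\<close> the observations enter additively with
  weights \<open>b ^ j\<close>.\<close>

primrec filter_rate :: "real \<Rightarrow> real \<Rightarrow> (nat \<Rightarrow> real) \<Rightarrow> nat \<Rightarrow> real" where
  "filter_rate b lam y 0 = lam"
| "filter_rate b lam y (Suc n) = filter_rate b lam y n / b + y (Suc n)"

lemma filter_rate_closed_form:
  assumes "b > 0"
  shows "b ^ n * filter_rate b lam y n = lam + (\<Sum>j=1..n. b ^ j * y j)"
proof (induction n)
  case (Suc n)
  have "b ^ Suc n * filter_rate b lam y (Suc n) = b ^ n * filter_rate b lam y n + b ^ Suc n * y (Suc n)"
    using assms by (simp add: field_simps)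
  then show ?case using Suc by simp
qed simp

lemma filter_rate_pos:
  assumes "b > 0" "lam > 0" "\<forall>j\<in>{1..n}. y j > 0"
  shows "filter_rate b lam y n > 0"
proof -
  have "(\<Sum>j=1..n. b ^ j * y j) \<ge> 0" using assms by (intro sum_nonneg) (simp add: less_imp_le)
  then have "b ^ n * filter_rate b lam y n > 0"
    unfolding filter_rate_closed_form[OF assms(1)] using assms(2) by simp
  then show ?thesis using assms(1) by (simp add: zero_less_mult_iff)
qed

text \<open>Iterates the filter step. With \<open>K = 0\<close> the filter stays exactly a Gamma
  density; for \<open>K > 0\<close> it approaches that same density as \<open>K / b ^ n\<close>
  becomes small relative to the rate.\<close>

lemma gamma_tilt_opt_filter:
  assumes "\<alpha> > 0" "\<beta> > 0" "b > 0" "lam > 0" "gamma_tilt lam (\<alpha> + \<beta>) K f"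
    and "\<forall>j\<in>{1..n}. y j > 0"
  shows "gamma_tilt (filter_rate b lam y n) (\<alpha> + \<beta>) (K / b ^ n) (opt_filter \<alpha> \<beta> b f y n)"
  using assms(6)
proof (induction n)
  case (Suc n)
  then have *: "\<forall>j\<in>{1..n}. y j > 0" "y (Suc n) > 0" by auto
  from gamma_tilt_filter_step[OF assms(1-3) filter_rate_pos[OF assms(3,4) *(1)] *(2) Suc.IH[OF *(1)]]
  show ?case by (simp add: mult.commute)
qed (use assms in simp)

section \<open>Total variation bounds\<close>

lemma tv_dist_self: "tv_dist \<mu> \<mu> = 0"
proof -
  have "sets \<mu> \<noteq> {}" using sets.top by blast
  then show ?thesis by (simp add: tv_dist_def)
qed

text \<open>Scheffe's identity: for equal total masses the supremum over sets is half the L1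
  distance, attained on the set where f >= g.\<close>

lemma tv_dist_density:
  fixes f g :: "'a \<Rightarrow> real"
  assumes f: "integrable M f" and g: "integrable M g"
    and f0: "\<And>x. x \<in> space M \<Longrightarrow> 0 \<le> f x" and g0: "\<And>x. x \<in> space M \<Longrightarrow> 0 \<le> g x"
    and eq: "integral\<^sup>L M f = integral\<^sup>L M g"
  shows "tv_dist (density M (\<lambda>x. ennreal (f x))) (density M (\<lambda>x. ennreal (g x)))
    = (\<integral>x. \<bar>f x - g x\<bar> \<partial>M) / 2"
proof -
  have measure_eq: "measure (density M (\<lambda>x. ennreal (u x))) A = (\<integral>x. indicator A x * u x \<partial>M)"
    if u: "integrable M u" "\<And>x. x \<in> space M \<Longrightarrow> 0 \<le> u x" and A: "A \<in> sets M" for u :: "'a \<Rightarrow> real" and A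
  proof -
    have "integrable M (\<lambda>x. indicator A x * u x)"
      using integrable_mult_indicator[OF A u(1)] by simp
    moreover have "emeasure (density M (\<lambda>x. ennreal (u x))) A
        = (\<integral>\<^sup>+x. ennreal (indicator A x * u x) \<partial>M)"
      using u(1) A by (subst emeasure_density) (auto intro!: nn_integral_cong simp: indicator_def)
    moreover have "AE x in M. 0 \<le> indicator A x * u x"
      by (rule AE_I2) (simp add: u(2))
    ultimately show ?thesis
      unfolding measure_def by (simp add: nn_integral_eq_integral integral_nonneg_AE)
  qed
  define d where "d x = f x - g x" for x
  have d: "integrable M d" and d0: "integral\<^sup>L M d = 0"
    using f g eq by (auto simp: d_def[abs_def])
  have ind: "integrable M (\<lambda>x. indicator A x * d x)" if "A \<in> sets M" for A
    using integrable_mult_indicator[OF that d] by simp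
  have diff: "measure (density M (\<lambda>x. ennreal (f x))) A - measure (density M (\<lambda>x. ennreal (g x))) A
      = (\<integral>x. indicator A x * d x \<partial>M)" if A: "A \<in> sets M" for A
    using integrable_mult_indicator[OF A f] integrable_mult_indicator[OF A g]
      measure_eq[of f A] measure_eq[of g A] f g f0 g0 A by (simp add: d_def right_diff_distrib)
  \<comment> \<open>Since \<open>d\<close> has integral 0, subtracting it changes nothing and
    replaces the indicator by a weight with values 1 and -1. This is where the factor 1/2 comes
    from.\<close>
  have split: "2 * (\<integral>x. indicator A x * d x \<partial>M) = (\<integral>x. (2 * indicator A x - 1) * d x \<partial>M)"
    if A: "A \<in> sets M" for A
    using ind[OF A] d d0 by (simp add: left_diff_distrib mult.assoc)
  have upper: "\<bar>\<integral>x. indicator A x * d x \<partial>M\<bar> \<le> (\<integral>x. \<bar>d x\<bar> \<partial>M) / 2" if A: "A \<in> sets M" for A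
  proof -
    have "\<bar>\<integral>x. (2 * indicator A x - 1) * d x \<partial>M\<bar> \<le> (\<integral>x. \<bar>(2 * indicator A x - 1) * d x\<bar> \<partial>M)"
      by (rule integral_abs_bound)
    also have "\<dots> = (\<integral>x. \<bar>d x\<bar> \<partial>M)"
      by (rule Bochner_Integration.integral_cong) (auto simp: indicator_def)
    finally show ?thesis unfolding split[OF A, symmetric] by simp
  qed
  \<comment> \<open>On this set the sign weight agrees with the sign of \<open>d\<close>, so the
    upper bound is attained.\<close>
  define P where "P = {x \<in> space M. d x \<ge> 0}"
  have [measurable]: "d \<in> borel_measurable M" using d by auto
  have P: "P \<in> sets M" unfolding P_def by measurable
  have "2 * (\<integral>x. indicator P x * d x \<partial>M) = (\<integral>x. \<bar>d x\<bar> \<partial>M)"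
    unfolding split[OF P] by (rule Bochner_Integration.integral_cong) (auto simp: P_def indicator_def)
  then have lower: "(\<integral>x. \<bar>d x\<bar> \<partial>M) / 2 \<le> \<bar>\<integral>x. indicator P x * d x \<partial>M\<bar>" by linarith
  have "tv_dist (density M (\<lambda>x. ennreal (f x))) (density M (\<lambda>x. ennreal (g x)))
      = (SUP A\<in>sets M. \<bar>\<integral>x. indicator A x * d x \<partial>M\<bar>)"
    unfolding tv_dist_def by (auto intro!: SUP_cong simp: diff)
  also have "\<dots> = (\<integral>x. \<bar>d x\<bar> \<partial>M) / 2"
  proof (rule antisym)
    show "(SUP A\<in>sets M. \<bar>\<integral>x. indicator A x * d x \<partial>M\<bar>) \<le> (\<integral>x. \<bar>d x\<bar> \<partial>M) / 2"
      using upper by (intro cSUP_least) auto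
    have "\<bar>\<integral>x. indicator P x * d x \<partial>M\<bar> \<le> (SUP A\<in>sets M. \<bar>\<integral>x. indicator A x * d x \<partial>M\<bar>)"
      using upper P by (intro cSUP_upper bdd_aboveI2[where M = "(\<integral>x. \<bar>d x\<bar> \<partial>M) / 2"]) auto
    with lower show "(\<integral>x. \<bar>d x\<bar> \<partial>M) / 2 \<le> (SUP A\<in>sets M. \<bar>\<integral>x. indicator A x * d x \<partial>M\<bar>)"
      by linarith
  qed
  finally show ?thesis by (simp add: d_def)
qed

text \<open>The mean absolute deviation of h is at most its standard deviation, which is at most L
  times the standard deviation \<open>sqrt r / l\<close> of the Gamma law. A pointwise quadratic
  bound takes the place of the Cauchy-Schwarz inequality.\<close>

lemma gamma_lipschitz_mean_deviation:
  fixes h :: "real \<Rightarrow> real"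
  assumes l: "l > 0" and r: "r > 0" and h: "L-lipschitz_on UNIV h"
    and mean: "(\<integral>x. gamma_density l r x * h x \<partial>lborel) = 1"
  shows "(\<integral>x. \<bar>gamma_density l r x * (h x - 1)\<bar> \<partial>lborel) \<le> L * sqrt r / l"
\<comment> \<open>The quadratic bound divides by a multiple of L. For \<open>L = 0\<close> the
  function is constant and equals its mean 1, so the deviation is 0.\<close>
proof (cases "L = 0")
  case True
  have const: "h = (\<lambda>_. h 0)" using lipschitz_onD[OF h, of _ 0] True by auto
  have "h 0 = 1"
    using mean has_bochner_integral_gamma_density[OF l r]
    by (subst (asm) const) (simp add: has_bochner_integral_iff)
  then show ?thesis using True by (subst const) simp
next
  case False
  then have L: "L > 0" using lipschitz_on_nonneg[OF h] by simp
  have g0: "gamma_density l r x \<ge> 0" for x using l r by (rule gamma_density_nonneg)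
  note g = has_bochner_integral_gamma_density[OF l r] gamma_density_mean[OF l r]
    gamma_density_second_moment[OF l r]
  define m where "m = r / l"
  \<comment> \<open>The integrated bound is (L^2 r / (l^2 t) + t) / 2. This \<open>t\<close>
    minimises it: both summands then equal \<open>t\<close>.\<close>
  define t where "t = L * sqrt r / l"
  have t: "t > 0" using L l r by (simp add: t_def)
  define c where "c = 1 - h m"
  have hb: "has_bochner_integral lborel (\<lambda>x. gamma_density l r x * h x) 1"
    using integrable_gamma_density_lipschitz[OF l r h] mean by (simp add: has_bochner_integral_iff)
  have "has_bochner_integral lborel (\<lambda>x. gamma_density l r x * x\<^sup>2 - 2 * m * (gamma_density l r x * x)
      + m\<^sup>2 * gamma_density l r x) (r * (r + 1) / l\<^sup>2 - 2 * m * (r / l) + m\<^sup>2 * 1)"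
    by (intro has_bochner_integral_add has_bochner_integral_diff has_bochner_integral_mult_right g)
  moreover have "r * (r + 1) / l\<^sup>2 - 2 * m * (r / l) + m\<^sup>2 * 1 = r / l\<^sup>2"
    using l by (simp add: m_def field_simps power2_eq_square)
  ultimately have var: "has_bochner_integral lborel (\<lambda>x. gamma_density l r x * (x - m)\<^sup>2) (r / l\<^sup>2)"
    by (simp add: power2_diff algebra_simps)
  have rhs: "has_bochner_integral lborel (\<lambda>x. (L\<^sup>2 / t * (gamma_density l r x * (x - m)\<^sup>2)
      - 2 * c / t * (gamma_density l r x * h x - gamma_density l r x) + t * gamma_density l r x) / 2)
      ((L\<^sup>2 / t * (r / l\<^sup>2) - 2 * c / t * (1 - 1) + t * 1) / 2)"
    by (intro has_bochner_integral_divide has_bochner_integral_add has_bochner_integral_diff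
        has_bochner_integral_mult_right g var hb)
  have "(\<integral>x. \<bar>gamma_density l r x * (h x - 1)\<bar> \<partial>lborel)
      \<le> (\<integral>x. (L\<^sup>2 / t * (gamma_density l r x * (x - m)\<^sup>2)
      - 2 * c / t * (gamma_density l r x * h x - gamma_density l r x) + t * gamma_density l r x) / 2 \<partial>lborel)"
  proof (rule integral_mono)
    show "integrable lborel (\<lambda>x. \<bar>gamma_density l r x * (h x - 1)\<bar>)"
      using has_bochner_integral_diff[OF hb g(1)]
      by (auto simp: right_diff_distrib has_bochner_integral_iff)
    show "integrable lborel (\<lambda>x. (L\<^sup>2 / t * (gamma_density l r x * (x - m)\<^sup>2)
      - 2 * c / t * (gamma_density l r x * h x - gamma_density l r x) + t * gamma_density l r x) / 2)"
      using rhs by (simp add: has_bochner_integral_iff)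
    \<comment> \<open>Completing squares: \<open>2 t \<bar>u\<bar> \<le> u\<^sup>2 + t\<^sup>2\<close> and \<open>u\<^sup>2 \<le> (u + c)\<^sup>2 - 2 c u\<close>, where \<open>u\<close> has mean zero
      and \<open>u + c = h x - h m\<close>.\<close>
    fix x
    define u where "u = h x - 1"
    have "\<bar>h x - h m\<bar> \<le> L * \<bar>x - m\<bar>"
      using lipschitz_onD[OF h, of x m] by (simp add: dist_real_def)
    then have "\<bar>h x - h m\<bar>\<^sup>2 \<le> (L * \<bar>x - m\<bar>)\<^sup>2" by (rule power_mono) simp
    then have "(u + c)\<^sup>2 \<le> L\<^sup>2 * (x - m)\<^sup>2"
      by (simp add: u_def c_def power_mult_distrib)
    moreover have "(u + c)\<^sup>2 = u\<^sup>2 + 2 * c * u + c\<^sup>2" by (simp add: power2_sum)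
    ultimately have u2: "u\<^sup>2 \<le> L\<^sup>2 * (x - m)\<^sup>2 - 2 * c * u"
      using zero_le_power2[of c] by linarith
    have "0 \<le> (\<bar>u\<bar> - t)\<^sup>2" by simp
    then have "2 * t * \<bar>u\<bar> \<le> u\<^sup>2 + t\<^sup>2" by (simp add: power2_diff algebra_simps)
    with u2 have "2 * t * \<bar>u\<bar> \<le> L\<^sup>2 * (x - m)\<^sup>2 - 2 * c * u + t\<^sup>2" by linarith
    then have "\<bar>u\<bar> \<le> (L\<^sup>2 * (x - m)\<^sup>2 - 2 * c * u + t\<^sup>2) / (2 * t)"
      using t by (simp add: pos_le_divide_eq mult_ac)
    also have "\<dots> = (L\<^sup>2 / t * (x - m)\<^sup>2 - 2 * c / t * u + t) / 2"
      using t by (simp add: field_simps power2_eq_square)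
    finally have "gamma_density l r x * \<bar>u\<bar> \<le> gamma_density l r x *
        ((L\<^sup>2 / t * (x - m)\<^sup>2 - 2 * c / t * u + t) / 2)"
      using g0 by (rule mult_left_mono)
    moreover have "gamma_density l r x * ((L\<^sup>2 / t * (x - m)\<^sup>2 - 2 * c / t * u + t) / 2)
      = (L\<^sup>2 / t * (gamma_density l r x * (x - m)\<^sup>2)
      - 2 * c / t * (gamma_density l r x * h x - gamma_density l r x) + t * gamma_density l r x) / 2"
      by (simp add: u_def add_divide_distrib diff_divide_distrib algebra_simps)
    ultimately show "\<bar>gamma_density l r x * (h x - 1)\<bar> \<le> (L\<^sup>2 / t * (gamma_density l r x * (x - m)\<^sup>2)
      - 2 * c / t * (gamma_density l r x * h x - gamma_density l r x) + t * gamma_density l r x) / 2"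
      using g0[of x] by (simp add: u_def abs_mult)
  qed
  also have "\<dots> = (L\<^sup>2 / t * (r / l\<^sup>2) + t) / 2"
    using rhs by (simp add: has_bochner_integral_iff)
  also have "L\<^sup>2 / t * (r / l\<^sup>2) = t"
  proof -
    have "L\<^sup>2 * (r / l\<^sup>2) = t * t"
      using r by (simp add: t_def power2_eq_square)
    then show ?thesis using t by (simp add: field_simps)
  qed
  finally show ?thesis by (simp add: t_def)
qed

lemma gamma_tilt_prob_density:
  assumes l: "l > 0" and r: "r > 0" and tilt: "gamma_tilt l r K f"
  shows "has_bochner_integral lborel (\<lambda>x. indicator {0<..} x * f x) 1"
    and "0 \<le> indicator {0<..} x * f x"
proof -
  obtain h H where H: "H > 0" and hH: "\<And>x. H \<le> h x" and hL: "(K * H)-lipschitz_on UNIV h"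
    and h1: "(\<integral>x. gamma_density l r x * h x \<partial>lborel) = 1"
    and f: "\<And>x. x > 0 \<Longrightarrow> f x = gamma_density l r x * h x"
    using tilt unfolding gamma_tilt_def by blast
  have eq: "indicator {0<..} x * f x = gamma_density l r x * h x" for x
    using f[of x] by (cases "x > 0") (simp_all add: gamma_density_def)
  show "has_bochner_integral lborel (\<lambda>x. indicator {0<..} x * f x) 1"
    unfolding eq using integrable_gamma_density_lipschitz[OF l r hL] h1
    by (simp add: has_bochner_integral_iff)
  have "0 \<le> h x" for x using hH[of x] H by linarith
  then show "0 \<le> indicator {0<..} x * f x" for x
    unfolding eq using gamma_density_nonneg[OF l r] by simp
qed

lemma tv_dist_gamma_tilt:
  assumes l: "l > 0" and r: "r > 0" and f: "gamma_tilt l r K f" and g: "gamma_tilt l r K' g"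
  shows "tv_dist (halfline_measure f) (halfline_measure g) =
    (\<integral>x. \<bar>indicator {0<..} x * f x - indicator {0<..} x * g x\<bar> \<partial>lborel) / 2"
  unfolding halfline_measure_def
  using gamma_tilt_prob_density[OF l r f] gamma_tilt_prob_density[OF l r g]
  by (intro tv_dist_density) (auto simp: has_bochner_integral_iff)

text \<open>The tilt of f has Lipschitz constant 0 and mean 1, so f is the Gamma density itself. The
  distance is then half the mean absolute deviation of the tilt \<open>k\<close> of g from its mean
  1.\<close>

lemma tv_dist_gamma_tilt_le:
  assumes l: "l > 0" and r: "r > 0" and f: "gamma_tilt l r 0 f" and g: "gamma_tilt l r K g"
  shows "tv_dist (halfline_measure f) (halfline_measure g) \<le> K * sqrt r / (2 * l)"
proof -
  obtain h where h0: "0-lipschitz_on UNIV h" and h1: "(\<integral>x. gamma_density l r x * h x \<partial>lborel) = 1"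
    and f_eq: "\<And>x. x > 0 \<Longrightarrow> f x = gamma_density l r x * h x"
    using f unfolding gamma_tilt_def by auto
  have const: "h = (\<lambda>_. h 0)" using lipschitz_onD[OF h0, of _ 0] by auto
  have "h 0 = 1"
    using h1 has_bochner_integral_gamma_density[OF l r]
    by (subst (asm) const) (simp add: has_bochner_integral_iff)
  then have f_gamma: "f x = gamma_density l r x" if "x > 0" for x
    using f_eq[OF that] by (subst (asm) const) simp
  obtain k H where H: "H > 0" and kH: "\<And>x. H \<le> k x" and kL: "(K * H)-lipschitz_on UNIV k"
    and k1: "(\<integral>x. gamma_density l r x * k x \<partial>lborel) = 1"
    and g_eq: "\<And>x. x > 0 \<Longrightarrow> g x = gamma_density l r x * k x"
    using g unfolding gamma_tilt_def by blast
  have K: "K \<ge> 0" using lipschitz_on_nonneg[OF kL] H by (simp add: zero_le_mult_iff)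
  \<comment> \<open>The lower bound \<open>H\<close> cannot exceed the mean 1 of \<open>k\<close>,
    so the Lipschitz constant \<open>K * H\<close> is at most the ratio \<open>K\<close>.\<close>
  have "H = (\<integral>x. gamma_density l r x * H \<partial>lborel)"
    using has_bochner_integral_gamma_density[OF l r] by (simp add: has_bochner_integral_iff)
  also have "\<dots> \<le> 1"
    unfolding k1[symmetric]
    using integrable_gamma_density_lipschitz[OF l r kL] kH has_bochner_integral_gamma_density[OF l r]
    by (intro integral_mono mult_left_mono gamma_density_nonneg l r)
       (auto simp: has_bochner_integral_iff)
  finally have "K * H \<le> K" using K by (simp add: mult_left_le)
  have "(\<integral>x. \<bar>indicator {0<..} x * f x - indicator {0<..} x * g x\<bar> \<partial>lborel)
      = (\<integral>x. \<bar>gamma_density l r x * (k x - 1)\<bar> \<partial>lborel)"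
  proof (rule Bochner_Integration.integral_cong)
    fix x :: real
    show "\<bar>indicator {0<..} x * f x - indicator {0<..} x * g x\<bar> = \<bar>gamma_density l r x * (k x - 1)\<bar>"
    proof (cases "x > 0")
      case True
      then show ?thesis by (simp add: f_gamma g_eq abs_minus_commute right_diff_distrib)
    qed (simp add: gamma_density_def)
  qed simp
  also have "\<dots> \<le> K * H * sqrt r / l"
    by (rule gamma_lipschitz_mean_deviation[OF l r kL k1])
  also have "\<dots> \<le> K * sqrt r / l"
    using \<open>K * H \<le> K\<close> l r by (intro divide_right_mono mult_right_mono) auto
  finally show ?thesis unfolding tv_dist_gamma_tilt[OF l r f g] by simp
qed

section \<open>Joint measurability of the filter in outcome and state\<close>

lemma trans_density_measurable [measurable]:
  "case_prod (trans_density \<alpha> \<beta> b) \<in> borel_measurable (borel \<Otimes>\<^sub>M borel)"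
proof -
  have "trans_density \<alpha> \<beta> b x y =
      (b * x) powr (1 - (\<alpha> + \<beta>)) / Beta \<alpha> \<beta> * y powr (\<alpha> - 1) * (b * x - y) powr (\<beta> - 1)
      * (if 0 \<le> y \<and> y \<le> b * x then 1 else 0)" for x y
    by (simp add: trans_density_def indicator_def)
  then show ?thesis unfolding split_beta' by simp
qed

lemma obs_density_measurable [measurable]:
  "case_prod (obs_density \<beta>) \<in> borel_measurable (borel \<Otimes>\<^sub>M borel)"
  unfolding obs_density_def split_beta' by simp

text \<open>Each step integrates out the state for a fixed outcome, and such integrals are
  measurable in the outcome when the integrand is jointly measurable; hence the induction is on
  joint measurability. The indicator is there because values off the half-line are
  arbitrary.\<close>

lemma opt_filter_measurable:
  assumes f: "(\<lambda>x. indicator {0<..} x * f x) \<in> borel_measurable borel"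
    and Y: "\<And>j. j \<ge> 1 \<Longrightarrow> Y j \<in> borel_measurable M"
  shows "(\<lambda>(\<omega>, x). indicator {0<..} x * opt_filter \<alpha> \<beta> b f (\<lambda>j. Y j \<omega>) n x)
    \<in> borel_measurable (M \<Otimes>\<^sub>M borel)"
proof (induction n)
  case 0
  from measurable_compose[OF measurable_snd f] show ?case by (simp add: split_beta')
next
  case (Suc n)
  define F where "F \<omega> s = indicator {0<..} s * opt_filter \<alpha> \<beta> b f (\<lambda>j. Y j \<omega>) n s" for \<omega> s
  have [measurable]: "case_prod F \<in> borel_measurable (M \<Otimes>\<^sub>M borel)"
    unfolding F_def[abs_def] by (rule Suc.IH)
  have [measurable]: "Y (Suc n) \<in> borel_measurable M" by (rule Y) simp
  define N where "N \<omega> x = (\<integral>s. trans_density \<alpha> \<beta> b s x * F \<omega> s \<partial>lborel)" for \<omega> x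
  have N_eq: "(LINT s:{0<..}|lborel. trans_density \<alpha> \<beta> b s x * opt_filter \<alpha> \<beta> b f (\<lambda>j. Y j \<omega>) n s)
      = N \<omega> x" for \<omega> x
    unfolding N_def F_def set_lebesgue_integral_def
    by (rule Bochner_Integration.integral_cong) (auto simp: mult_ac)
  have [measurable]: "case_prod N \<in> borel_measurable (M \<Otimes>\<^sub>M borel)"
    unfolding N_def[abs_def] by measurable
  define D where "D \<omega> = (\<integral>z. indicator {0<..} z * (obs_density \<beta> z (Y (Suc n) \<omega>) * N \<omega> z) \<partial>lborel)" for \<omega>
  have [measurable]: "D \<in> borel_measurable M"
    unfolding D_def[abs_def] by measurable
  have "indicator {0<..} x * opt_filter \<alpha> \<beta> b f (\<lambda>j. Y j \<omega>) (Suc n) x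
      = indicator {0<..} x * (obs_density \<beta> x (Y (Suc n) \<omega>) * N \<omega> x / D \<omega>)" for \<omega> x
    by (simp only: opt_filter.simps N_eq) (simp add: D_def set_lebesgue_integral_def)
  then show ?case unfolding split_beta' by simp
qed

section \<open>Distance of the two filters for a given observation sequence\<close>

lemma opt_filter_eq_0:
  assumes "j \<in> {1..n}" and "y j \<le> 0"
  shows "opt_filter \<alpha> \<beta> b f y n x = 0"
  using assms
proof (induction n arbitrary: x)
  case (Suc n)
  show ?case
  proof (cases "j = Suc n")
    case True
    then show ?thesis using Suc.prems by (simp add: obs_density_def)
  next
    case False
    then have "opt_filter \<alpha> \<beta> b f y n x = 0" for x using Suc by auto
    then show ?thesis by simp
  qed
qed simp

text \<open>The L1 formula holds for every real observation sequence, so the distance is an integral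
  at every outcome and not a supremum over uncountably many sets; its measurability rests on this.
  The decay estimate needs positive observations, whereas the bound by 1 holds for all.\<close>

lemma
  assumes \<alpha>: "\<alpha> > 0" and \<beta>: "\<beta> > 0" and b: "b > 0" and lam: "lam > 0"
    and f: "gamma_tilt lam (\<alpha> + \<beta>) 0 f" and g: "gamma_tilt lam (\<alpha> + \<beta>) K g"
  shows filter_dist_eq: "filter_dist \<alpha> \<beta> b f g y n = (\<integral>x. \<bar>indicator {0<..} x * opt_filter \<alpha> \<beta> b f y n x
      - indicator {0<..} x * opt_filter \<alpha> \<beta> b g y n x\<bar> \<partial>lborel) / 2"
    and filter_dist_le: "\<forall>j\<in>{1..n}. y j > 0 \<Longrightarrow>
      filter_dist \<alpha> \<beta> b f g y n \<le> K * sqrt (\<alpha> + \<beta>) / (2 * (lam + (\<Sum>j=1..n. b ^ j * y j)))"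
    and filter_dist_le_1: "filter_dist \<alpha> \<beta> b f g y n \<le> 1"
proof -
  have q: "\<alpha> + \<beta> > 0" using \<alpha> \<beta> by simp
  note pos = filter_rate_pos[OF b lam, of n y]
  note tilt = gamma_tilt_opt_filter[OF \<alpha> \<beta> b lam f, of n y] gamma_tilt_opt_filter[OF \<alpha> \<beta> b lam g, of n y]
  show eq: "filter_dist \<alpha> \<beta> b f g y n = (\<integral>x. \<bar>indicator {0<..} x * opt_filter \<alpha> \<beta> b f y n x
      - indicator {0<..} x * opt_filter \<alpha> \<beta> b g y n x\<bar> \<partial>lborel) / 2"
    \<comment> \<open>a nonpositive observation has likelihood \<open>0\<close>, so both filters are \<open>0/0 = 0\<close> from then on\<close>
  proof (cases "\<forall>j\<in>{1..n}. y j > 0")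
    case True
    then show ?thesis
      unfolding filter_dist_def using tv_dist_gamma_tilt[OF pos q tilt] by simp
  next
    case False
    then obtain j where "j \<in> {1..n}" "y j \<le> 0" by force
    then have "opt_filter \<alpha> \<beta> b u y n = (\<lambda>_. 0)" for u
      by (intro ext opt_filter_eq_0)
    then show ?thesis by (simp add: filter_dist_def tv_dist_self)
  qed
  show "filter_dist \<alpha> \<beta> b f g y n \<le> K * sqrt (\<alpha> + \<beta>) / (2 * (lam + (\<Sum>j=1..n. b ^ j * y j)))"
    if y: "\<forall>j\<in>{1..n}. y j > 0"
  proof -
    have "filter_dist \<alpha> \<beta> b f g y n \<le> K / b ^ n * sqrt (\<alpha> + \<beta>) / (2 * filter_rate b lam y n)"
      unfolding filter_dist_def
      by (rule tv_dist_gamma_tilt_le[OF pos[OF y] q]) (use tilt[OF y] in simp_all)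
    also have "\<dots> = K * sqrt (\<alpha> + \<beta>) / (2 * (b ^ n * filter_rate b lam y n))"
      by simp
    finally show ?thesis unfolding filter_rate_closed_form[OF b] .
  qed
  show "filter_dist \<alpha> \<beta> b f g y n \<le> 1"
  proof (cases "\<forall>j\<in>{1..n}. y j > 0")
    case True
    note F = gamma_tilt_prob_density[OF pos[OF True] q tilt(1)[OF True]]
    note G = gamma_tilt_prob_density[OF pos[OF True] q tilt(2)[OF True]]
    have "(\<integral>x. \<bar>indicator {0<..} x * opt_filter \<alpha> \<beta> b f y n x
      - indicator {0<..} x * opt_filter \<alpha> \<beta> b g y n x\<bar> \<partial>lborel)
      \<le> (\<integral>x. indicator {0<..} x * opt_filter \<alpha> \<beta> b f y n x
      + indicator {0<..} x * opt_filter \<alpha> \<beta> b g y n x \<partial>lborel)"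
    proof (rule integral_mono)
      show "\<bar>indicator {0<..} x * opt_filter \<alpha> \<beta> b f y n x
          - indicator {0<..} x * opt_filter \<alpha> \<beta> b g y n x\<bar>
        \<le> indicator {0<..} x * opt_filter \<alpha> \<beta> b f y n x
          + indicator {0<..} x * opt_filter \<alpha> \<beta> b g y n x" for x
        using F(2)[of x] G(2)[of x] by linarith
    qed (use F(1) G(1) in \<open>auto simp: has_bochner_integral_iff\<close>)
    also have "\<dots> = 2" using F(1) G(1) by (simp add: has_bochner_integral_iff)
    finally show ?thesis unfolding eq by simp
  next
    case False
    then obtain j where "j \<in> {1..n}" "y j \<le> 0" by force
    then show ?thesis unfolding eq by (simp add: opt_filter_eq_0)
  qed
qed

section \<open>Moments, Lipschitz extension and tilt form of the initial density\<close>

lemma integrable_gamma_tilt_powr: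
  assumes l: "l > 0" and r: "r > 0" and p: "p > 0" and tilt: "gamma_tilt l r K f"
  shows "integrable lborel (\<lambda>x. indicator {0<..} x * f x * x powr p)"
proof -
  obtain h H where hL: "(K * H)-lipschitz_on UNIV h"
    and f: "\<And>x. x > 0 \<Longrightarrow> f x = gamma_density l r x * h x"
    using tilt unfolding gamma_tilt_def by blast
  have rp: "r + p > 0" using r p by simp
  \<comment> \<open>The power is absorbed into the shape, so it remains to integrate a Lipschitz
    function against another Gamma density.\<close>
  have "indicator {0<..} x * f x * x powr p =
      Gamma (r + p) / (Gamma r * l powr p) * (gamma_density l (r + p) x * h x)" for x
  proof (cases "x > 0")
    case True
    then show ?thesis
      using f[OF True] gamma_density_times_powr[OF l r rp, of x] by (simp add: mult_ac)
  qed (simp add: gamma_density_def)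
  then show ?thesis
    using integrable_gamma_density_lipschitz[OF l rp hL] by simp
qed

text \<open>The ratio is given on the open half-line only. It extends to the closure with the same
  constant, and composing with the 1-Lipschitz retraction \<open>max 0\<close> gives a function on
  the whole line, as \<open>gamma_tilt\<close> demands.\<close>

lemma gamma_tilt_of_lipschitz_ratio:
  assumes l: "l > 0" and r: "r > 0" and f: "halfline_prob_density f"
    and L: "L-lipschitz_on {0<..} (\<lambda>x. f x / gamma_density l r x)"
    and H: "H > 0" "\<And>x. x > 0 \<Longrightarrow> H \<le> f x / gamma_density l r x"
  shows "gamma_tilt l r (L / H) f"
proof -
  have pos: "gamma_density l r x > 0" if "x > 0" for x
    using that l r by (simp add: gamma_density_def Gamma_real_pos)
  obtain g where g: "L-lipschitz_on {0..} g" "\<And>x. x > 0 \<Longrightarrow> g x = f x / gamma_density l r x"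
    using lipschitz_extend_closure[OF L] by auto
  define h where "h x = g (max 0 x)" for x
  have hL: "L-lipschitz_on UNIV h"
  proof (rule lipschitz_onI)
    fix x y :: real
    have "dist (h x) (h y) \<le> L * dist (max 0 x) (max 0 y)"
      unfolding h_def by (rule lipschitz_onD[OF g(1)]) auto
    also have "\<dots> \<le> L * dist x y"
      using lipschitz_on_nonneg[OF L] by (intro mult_left_mono) (auto simp: dist_real_def)
    finally show "dist (h x) (h y) \<le> L * dist x y" .
  qed (rule lipschitz_on_nonneg[OF L])
  have pos_ge: "H \<le> g x" if "x > 0" for x using H(2)[OF that] g(2)[OF that] by simp
  \<comment> \<open>The new value at 0 is a limit from the right and inherits the bound.\<close>
  have "H \<le> g 0"
  proof (rule tendsto_lowerbound)
    have "continuous_on {0..} g" using g(1) by (rule lipschitz_on_continuous_on)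
    then have "(g \<longlongrightarrow> g 0) (at 0 within {0..})" by (simp add: continuous_on_def)
    then show "(g \<longlongrightarrow> g 0) (at_right 0)" by (rule tendsto_within_subset) auto
    show "\<forall>\<^sub>F x in at_right 0. H \<le> g x"
      using eventually_at_right_less by eventually_elim (rule pos_ge)
  qed simp
  with pos_ge have hH: "H \<le> h x" for x by (cases "x > 0") (auto simp: h_def max_def)
  have f_eq: "f x = gamma_density l r x * h x" if "x > 0" for x
    using g(2)[OF that] pos[OF that] that by (simp add: h_def)
  then have eq: "indicator {0<..} x * f x = gamma_density l r x * h x" for x
    by (cases "x > 0") (simp_all add: gamma_density_def)
  have "(\<integral>\<^sup>+x. ennreal (gamma_density l r x * h x) \<partial>lborel) = 1"
    using f unfolding halfline_prob_density_def eq by simp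
  moreover have "gamma_density l r x * h x \<ge> 0" for x
    using H(1) hH[of x] gamma_density_nonneg[OF l r, of x] by simp
  ultimately have "(\<integral>x. gamma_density l r x * h x \<partial>lborel) = 1"
    using integrable_gamma_density_lipschitz[OF l r hL]
    by (subst integral_eq_nn_integral) auto
  then show ?thesis
    unfolding gamma_tilt_def using hL hH H(1) f_eq by (intro exI[of _ h] exI[of _ H]) auto
qed

text \<open>The infimum is attained: every difference quotient is a lower bound of the set of
  admissible constants, hence at most its infimum.\<close>

lemma lip_const_lipschitz_on:
  assumes "L-lipschitz_on S f"
  shows "(lip_const S f)-lipschitz_on S f"
proof -
  let ?A = "{L. L-lipschitz_on S f}"
  have ne: "?A \<noteq> {}" using assms by auto
  show ?thesis
  proof (rule lipschitz_onI)
    show "lip_const S f \<ge> 0"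
      unfolding lip_const_def using ne by (rule cInf_greatest) (auto dest: lipschitz_on_nonneg)
    fix x y assume xy: "x \<in> S" "y \<in> S"
    show "dist (f x) (f y) \<le> lip_const S f * dist x y"
    proof (cases "x = y")
      case False
      have "dist (f x) (f y) / dist x y \<le> lip_const S f"
        unfolding lip_const_def using ne
      proof (rule cInf_greatest)
        fix M assume "M \<in> ?A"
        then show "dist (f x) (f y) / dist x y \<le> M"
          using lipschitz_onD[of M S f x y] xy False by (simp add: pos_divide_le_eq)
      qed
      then show ?thesis using False by (simp add: pos_divide_le_eq)
    qed simp
  qed
qed

section \<open>Moments along the hidden Markov model\<close>

lemma (in hidden_markov_model) measurable_sources:
  shows "X 0 \<in> borel_measurable M"
    and "n \<ge> 1 \<Longrightarrow> W n \<in> borel_measurable M"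
    and "n \<ge> 1 \<Longrightarrow> G n \<in> borel_measurable M"
  using distributed_measurable[OF init] distributed_measurable[OF signal_noise, of n]
    distributed_measurable[OF obs_noise, of n] by simp_all

lemma (in hidden_markov_model) signal_eq:
  "\<omega> \<in> space M \<Longrightarrow> X n \<omega> = b ^ n * X 0 \<omega> * (\<Prod>j=1..n. W j \<omega>)"
proof (induction n)
  case (Suc n)
  then show ?case using signal[of "Suc n" \<omega>] by simp
qed simp

lemma (in hidden_markov_model) observation_measurable:
  assumes "n \<ge> 1"
  shows "Y n \<in> borel_measurable M"
proof -
  have "(\<lambda>\<omega>. \<Prod>j=1..n. W j \<omega>) \<in> borel_measurable M"
    by (rule borel_measurable_prod) (simp add: measurable_sources)
  then have "(\<lambda>\<omega>. inverse (b ^ n * X 0 \<omega> * (\<Prod>j=1..n. W j \<omega>)) * G n \<omega>) \<in> borel_measurable M"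
    using assms measurable_sources by simp
  then show ?thesis
    by (rule measurable_cong[THEN iffD2, rotated]) (simp add: observation[OF assms] signal_eq[of _ n])
qed

lemma (in hidden_markov_model) AE_sources_pos:
  "AE \<omega> in M. X 0 \<omega> > 0 \<and> (\<forall>n\<ge>1. W n \<omega> > 0 \<and> G n \<omega> > 0)"
proof -
  have "AE \<omega> in M. X 0 \<omega> > 0"
    by (subst distributed_AE2[OF init]) (auto simp: indicator_def)
  moreover have "AE \<omega> in M. \<forall>n. n \<ge> 1 \<longrightarrow> W n \<omega> > 0"
    unfolding AE_all_countable
  proof
    fix n :: nat
    show "AE \<omega> in M. n \<ge> 1 \<longrightarrow> W n \<omega> > 0"
      by (cases "n \<ge> 1")
         (auto simp: distributed_AE2[OF signal_noise] beta_density_def indicator_def)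
  qed
  moreover have "AE \<omega> in M. \<forall>n. n \<ge> 1 \<longrightarrow> G n \<omega> > 0"
    unfolding AE_all_countable
  proof
    fix n :: nat
    show "AE \<omega> in M. n \<ge> 1 \<longrightarrow> G n \<omega> > 0"
      by (cases "n \<ge> 1")
         (auto simp: distributed_AE2[OF obs_noise] gamma_density_def indicator_def)
  qed
  ultimately show ?thesis by eventually_elim auto
qed

lemma (in hidden_markov_model) signal_noise_moment:
  assumes "\<alpha> > 0" "\<beta> > 0" "p > 0" "n \<ge> 1"
  shows "integrable M (\<lambda>\<omega>. W n \<omega> powr p)"
    and "expectation (\<lambda>\<omega>. W n \<omega> powr p) = Beta (\<alpha> + p) \<beta> / Beta \<alpha> \<beta>"
proof -
  have nn: "beta_density \<alpha> \<beta> x \<ge> 0" for x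
    using assms by (auto simp: beta_density_def indicator_def Beta_def Gamma_real_nonneg)
  have "has_bochner_integral lborel (\<lambda>x. beta_density \<alpha> \<beta> x * x powr p) (Beta (\<alpha> + p) \<beta> / Beta \<alpha> \<beta>)"
    using assms by (intro beta_density_moment) auto
  then show "integrable M (\<lambda>\<omega>. W n \<omega> powr p)"
    and "expectation (\<lambda>\<omega>. W n \<omega> powr p) = Beta (\<alpha> + p) \<beta> / Beta \<alpha> \<beta>"
    using distributed_integrable[OF signal_noise[OF assms(4)], of "\<lambda>x. x powr p"]
      distributed_integral[OF signal_noise[OF assms(4)], of "\<lambda>x. x powr p"] nn
    by (auto simp: has_bochner_integral_iff)
qed

text \<open>The weight shifts the shape of the Gamma law to \<open>\<beta> - p\<close>. Its
  positivity is the origin of the range \<open>p < \<beta>\<close> in part (iii).\<close>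

lemma (in hidden_markov_model) obs_noise_negative_moment:
  assumes "p < \<beta>" "\<beta> > 0" "n \<ge> 1"
  shows "integrable M (\<lambda>\<omega>. G n \<omega> powr - p)"
    and "expectation (\<lambda>\<omega>. G n \<omega> powr - p) = Gamma (\<beta> - p) / Gamma \<beta>"
proof -
  have "has_bochner_integral lborel (\<lambda>x. gamma_density 1 \<beta> x * x powr - p) (Gamma (\<beta> - p) / Gamma \<beta>)"
    using gamma_density_moment[of 1 \<beta> "- p"] assms by simp
  then show "integrable M (\<lambda>\<omega>. G n \<omega> powr - p)"
    and "expectation (\<lambda>\<omega>. G n \<omega> powr - p) = Gamma (\<beta> - p) / Gamma \<beta>"
    using distributed_integrable[OF obs_noise[OF assms(3)], of "\<lambda>x. x powr - p"]
      distributed_integral[OF obs_noise[OF assms(3)], of "\<lambda>x. x powr - p"]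
      gamma_density_nonneg[of 1 \<beta>] assms(2)
    by (auto simp: has_bochner_integral_iff)
qed

lemma (in hidden_markov_model) init_moment:
  assumes "l > 0" "r > 0" "p > 0" "gamma_tilt l r K f"
  shows "integrable M (\<lambda>\<omega>. X 0 \<omega> powr p)"
  using distributed_integrable[OF init, of "\<lambda>x. x powr p"]
    integrable_gamma_tilt_powr[OF assms] gamma_tilt_prob_density(2)[OF assms(1,2,4)] by simp

lemma (in hidden_markov_model) filter_dist_measurable:
  assumes "\<alpha> > 0" "\<beta> > 0" "b > 0" "lam > 0"
    and "gamma_tilt lam (\<alpha> + \<beta>) 0 g" and "gamma_tilt lam (\<alpha> + \<beta>) K g'"
    and "(\<lambda>x. indicator {0<..} x * g x) \<in> borel_measurable borel"
    and "(\<lambda>x. indicator {0<..} x * g' x) \<in> borel_measurable borel"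
  shows "(\<lambda>\<omega>. filter_dist \<alpha> \<beta> b g g' (\<lambda>j. Y j \<omega>) n) \<in> borel_measurable M"
proof -
  note [measurable] = opt_filter_measurable[OF assms(7) observation_measurable]
    opt_filter_measurable[OF assms(8) observation_measurable]
  show ?thesis
    unfolding filter_dist_eq[OF assms(1-6)] by measurable
qed

text \<open>Discarding \<open>lam\<close> and all observations but the last weakens the bound to a
  product of independent sources, whose power moments factorise.\<close>

lemma (in hidden_markov_model) filter_dist_le_sources:
  assumes "\<alpha> > 0" "\<beta> > 0" "b > 0" "lam > 0" "K \<ge> 0"
    and "gamma_tilt lam (\<alpha> + \<beta>) 0 g" and "gamma_tilt lam (\<alpha> + \<beta>) K g'" and n: "n \<ge> 1"
  shows "AE \<omega> in M. filter_dist \<alpha> \<beta> b g g' (\<lambda>j. Y j \<omega>) n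
    \<le> K * sqrt (\<alpha> + \<beta>) / 2 * (X 0 \<omega> * (\<Prod>j=1..n. W j \<omega>) / G n \<omega>)"
  using AE_sources_pos AE_space
proof eventually_elim
  case (elim \<omega>)
  have X: "X j \<omega> > 0" for j
    using elim assms(3) by (subst signal_eq) (auto intro!: mult_pos_pos prod_pos)
  have Y: "Y j \<omega> > 0" if "j \<ge> 1" for j
    using observation[OF that elim(2)] X elim that by simp
  define P where "P = X 0 \<omega> * (\<Prod>j=1..n. W j \<omega>)"
  have P: "P > 0" using elim by (auto simp: P_def intro!: mult_pos_pos prod_pos)
  have G: "G n \<omega> > 0" using elim n by simp
  \<comment> \<open>The signal at time n carries the factor \<open>b ^ n\<close>, which cancels
    exactly.\<close>
  have "b ^ n * Y n \<omega> = G n \<omega> / P"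
    using observation[OF n elim(2)] signal_eq[OF elim(2), of n] assms(3)
    by (simp add: P_def field_simps)
  moreover have "b ^ n * Y n \<omega> \<le> (\<Sum>j=1..n. b ^ j * Y j \<omega>)"
    using n assms(3) Y by (intro member_le_sum) (auto intro!: mult_nonneg_nonneg less_imp_le)
  ultimately have le: "G n \<omega> / P \<le> lam + (\<Sum>j=1..n. b ^ j * Y j \<omega>)"
    using assms(4) by linarith
  have "filter_dist \<alpha> \<beta> b g g' (\<lambda>j. Y j \<omega>) n
      \<le> K * sqrt (\<alpha> + \<beta>) / (2 * (lam + (\<Sum>j=1..n. b ^ j * Y j \<omega>)))"
    using assms Y by (intro filter_dist_le) auto
  also have "\<dots> \<le> K * sqrt (\<alpha> + \<beta>) / (2 * (G n \<omega> / P))"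
  proof (rule divide_left_mono)
    have "0 < G n \<omega> / P" using G P by simp
    then show "0 < 2 * (lam + (\<Sum>j=1..n. b ^ j * Y j \<omega>)) * (2 * (G n \<omega> / P))"
      using le by (intro mult_pos_pos) linarith+
  qed (use le assms(1,2,5) in auto)
  finally show ?case by (simp add: P_def)
qed

lemma (in hidden_markov_model) source_product_moment:
  assumes "\<alpha> > 0" "\<beta> > 0" "lam > 0" "0 < p" "p < \<beta>" and n: "n \<ge> 1"
    and f: "gamma_tilt lam (\<alpha> + \<beta>) K f"
  shows "has_bochner_integral M
    (\<lambda>\<omega>. X 0 \<omega> powr p * (\<Prod>j=1..n. W j \<omega> powr p) * G n \<omega> powr - p)
    (expectation (\<lambda>\<omega>. X 0 \<omega> powr p) * (Beta (\<alpha> + p) \<beta> / Beta \<alpha> \<beta>) ^ n * (Gamma (\<beta> - p) / Gamma \<beta>))"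
proof -
  define I where "I = {Init, ObsNoise n} \<union> SignalNoise ` {1..n}"
  \<comment> \<open>The observation noise stands in the denominator of the bound and gets exponent
    \<open>- p\<close>; the other sources get \<open>p\<close>.\<close>
  define e where "e i = (case i of ObsNoise _ \<Rightarrow> - p | _ \<Rightarrow> p)" for i
  define Z where "Z i \<omega> = sources X W G i \<omega> powr e i" for i \<omega>
  have prod_I: "prod u I = u Init * (\<Prod>j=1..n. u (SignalNoise j)) * u (ObsNoise n)" for u :: "source \<Rightarrow> real"
  proof -
    have "prod u I = prod u {Init, ObsNoise n} * prod u (SignalNoise ` {1..n})"
      unfolding I_def by (rule prod.union_disjoint) auto
    also have "prod u (SignalNoise ` {1..n}) = (\<Prod>j=1..n. u (SignalNoise j))"
      by (subst prod.reindex) (auto simp: inj_on_def)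
    finally show ?thesis by simp
  qed
  have "indep_vars (\<lambda>_. borel) (sources X W G) I"
    by (rule indep_vars_subset[OF indep]) (use n in \<open>auto simp: I_def\<close>)
  then have ind: "indep_vars (\<lambda>_. borel) Z I"
    unfolding Z_def[abs_def] by (rule indep_vars_compose2) simp
  have q: "\<alpha> + \<beta> > 0" using assms by simp
  have int: "integrable M (Z i)" if "i \<in> I" for i
    using that init_moment[OF \<open>lam > 0\<close> q \<open>0 < p\<close> f] signal_noise_moment(1)[OF assms(1,2,4)]
      obs_noise_negative_moment(1)[OF assms(5,2) n]
    by (auto simp: I_def Z_def[abs_def] e_def)
  have fin: "finite I" by (simp add: I_def)
  have "(\<integral>\<omega>. (\<Prod>i\<in>I. Z i \<omega>) \<partial>M) = (\<Prod>i\<in>I. \<integral>\<omega>. Z i \<omega> \<partial>M)"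
    by (rule indep_vars_lebesgue_integral[OF fin ind int])
  moreover have "integrable M (\<lambda>\<omega>. \<Prod>i\<in>I. Z i \<omega>)"
    by (rule indep_vars_integrable[OF fin ind int])
  moreover have "(\<Prod>i\<in>I. \<integral>\<omega>. Z i \<omega> \<partial>M) = expectation (\<lambda>\<omega>. X 0 \<omega> powr p)
      * (Beta (\<alpha> + p) \<beta> / Beta \<alpha> \<beta>) ^ n * (Gamma (\<beta> - p) / Gamma \<beta>)"
    unfolding prod_I using signal_noise_moment(2)[OF assms(1,2,4)]
      obs_noise_negative_moment(2)[OF assms(5,2) n]
    by (simp add: Z_def[abs_def] e_def)
  ultimately show ?thesis
    unfolding prod_I by (simp add: has_bochner_integral_iff Z_def e_def)
qed

text \<open>Takes p-th powers in the almost sure bound and uses independence: each signal noise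
  contributes one factor \<rho>. The constant does not depend on n, so the estimate yields (iii) and
  can be summed for (ii).\<close>

lemma (in hidden_markov_model) filter_dist_moment_bound:
  assumes "\<alpha> > 0" "\<beta> > 0" "b > 0" "lam > 0" "K \<ge> 0"
    and g: "gamma_tilt lam (\<alpha> + \<beta>) 0 g" and f: "gamma_tilt lam (\<alpha> + \<beta>) K f"
    and m: "(\<lambda>x. indicator {0<..} x * g x) \<in> borel_measurable borel"
     "(\<lambda>x. indicator {0<..} x * f x) \<in> borel_measurable borel"
    and p: "0 < p" "p < \<beta>"
  defines "D \<equiv> \<lambda>n \<omega>. filter_dist \<alpha> \<beta> b g f (\<lambda>j. Y j \<omega>) n"
  shows "integrable M (\<lambda>\<omega>. D n \<omega> powr p)"
    and "\<exists>C\<ge>0. \<forall>n. expectation (\<lambda>\<omega>. D n \<omega> powr p) \<le> C * (Beta (\<alpha> + p) \<beta> / Beta \<alpha> \<beta>) ^ n"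
proof -
  have [measurable]: "D n \<in> borel_measurable M" for n
    unfolding D_def by (rule filter_dist_measurable[OF assms(1-4) g f m])
  have D0: "D n \<omega> \<ge> 0" and D1: "D n \<omega> \<le> 1" for n \<omega>
    unfolding D_def using filter_dist_le_1[OF assms(1-4) g f]
    by (auto simp: filter_dist_eq[OF assms(1-4) g f])
  have Dp1: "D n \<omega> powr p \<le> 1" for n \<omega>
    using powr_mono2[OF less_imp_le[OF p(1)] D0 D1, of n \<omega>] by simp
  show int: "integrable M (\<lambda>\<omega>. D n \<omega> powr p)" for n
    by (rule integrable_const_bound[where B = 1]) (use Dp1 in auto)
  define c where "c = K * sqrt (\<alpha> + \<beta>) / 2"
  have c: "c \<ge> 0" using assms by (simp add: c_def)
  define \<rho> where "\<rho> = Beta (\<alpha> + p) \<beta> / Beta \<alpha> \<beta>"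
  define A where "A = c powr p * expectation (\<lambda>\<omega>. X 0 \<omega> powr p) * (Gamma (\<beta> - p) / Gamma \<beta>)"
  have bound: "expectation (\<lambda>\<omega>. D n \<omega> powr p) \<le> A * \<rho> ^ n" if n: "n \<ge> 1" for n
  proof -
    note hb = source_product_moment[OF assms(1,2,4) p n f, folded \<rho>_def]
    have "expectation (\<lambda>\<omega>. D n \<omega> powr p) \<le> expectation (\<lambda>\<omega>. c powr p *
        (X 0 \<omega> powr p * (\<Prod>j=1..n. W j \<omega> powr p) * G n \<omega> powr - p))"
    proof (rule integral_mono_AE)
      show "integrable M (\<lambda>\<omega>. c powr p * (X 0 \<omega> powr p * (\<Prod>j=1..n. W j \<omega> powr p) * G n \<omega> powr - p))"
        using hb by (intro integrable_mult_right) (simp add: has_bochner_integral_iff)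
      show "AE \<omega> in M. D n \<omega> powr p \<le> c powr p *
          (X 0 \<omega> powr p * (\<Prod>j=1..n. W j \<omega> powr p) * G n \<omega> powr - p)"
        using filter_dist_le_sources[OF assms(1-5) g f n] AE_sources_pos
      proof eventually_elim
        case (elim \<omega>)
        have W: "(\<Prod>j=1..n. W j \<omega>) > 0" using elim by (auto intro!: prod_pos)
        have X0: "X 0 \<omega> > 0" and G0: "G n \<omega> > 0" using elim n by auto
        have "D n \<omega> powr p \<le> (c * (X 0 \<omega> * (\<Prod>j=1..n. W j \<omega>) / G n \<omega>)) powr p"
          using elim(1) p D0 by (intro powr_mono2) (auto simp: D_def c_def)
        also have "\<dots> = c powr p * (X 0 \<omega> powr p * (\<Prod>j=1..n. W j \<omega>) powr p / G n \<omega> powr p)"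
          using c W X0 G0 by (simp add: powr_mult powr_divide)
        also have "(\<Prod>j=1..n. W j \<omega>) powr p = (\<Prod>j=1..n. W j \<omega> powr p)"
          by (rule prod_powr_distrib)
        finally show ?case by (simp add: powr_minus divide_inverse mult_ac)
      qed
    qed (rule int)
    also have "\<dots> = A * \<rho> ^ n"
      using hb by (simp add: has_bochner_integral_iff A_def)
    finally show ?thesis .
  qed
  have \<rho>: "\<rho> > 0"
    using assms(1,2) p by (simp add: \<rho>_def Beta_real_pos)
  \<comment> \<open>The 1 in the maximum covers \<open>n = 0\<close>: there is no observation yet,
    and the distance is bounded by 1.\<close>
  have "expectation (\<lambda>\<omega>. D n \<omega> powr p) \<le> max 1 A * \<rho> ^ n" for n
  proof (cases "n \<ge> 1")
    case True
    have "A * \<rho> ^ n \<le> max 1 A * \<rho> ^ n" using \<rho> by (intro mult_right_mono) auto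
    with bound[OF True] show ?thesis by linarith
  next
    case False
    have "expectation (\<lambda>\<omega>. D n \<omega> powr p) \<le> expectation (\<lambda>\<omega>. 1)"
      using int Dp1 by (intro integral_mono) auto
    then show ?thesis using False by (simp add: prob_space not_less_eq_eq)
  qed
  then show "\<exists>C\<ge>0. \<forall>n. expectation (\<lambda>\<omega>. D n \<omega> powr p) \<le> C * (Beta (\<alpha> + p) \<beta> / Beta \<alpha> \<beta>) ^ n"
    unfolding \<rho>_def by (intro exI[of _ "max 1 A"]) auto
qed

section \<open>From moment decay to almost sure decay\<close>

lemma (in prob_space) expectation_sq_le:
  fixes U :: "'a \<Rightarrow> real"
  assumes "integrable M U" and "integrable M (\<lambda>\<omega>. (U \<omega>)\<^sup>2)"
  shows "(expectation U)\<^sup>2 \<le> expectation (\<lambda>\<omega>. (U \<omega>)\<^sup>2)"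
  using variance_eq[OF assms] variance_positive[of U] by simp

text \<open>The series of the weighted powers \<open>S n\<close> has expectation dominated by a
  convergent geometric series, so it converges almost surely. Its terms are then bounded by a
  constant depending on the outcome, and taking p-th roots gives the rate.\<close>

lemma (in prob_space) AE_bigo_of_geometric_moments:
  fixes D :: "nat \<Rightarrow> 'a \<Rightarrow> real"
  assumes D0: "\<And>n \<omega>. 0 \<le> D n \<omega>" and p: "p > 0" and \<delta>: "\<delta> > 0"
    and int: "\<And>n. integrable M (\<lambda>\<omega>. D n \<omega> powr p)"
    and bound: "\<And>n. expectation (\<lambda>\<omega>. D n \<omega> powr p) \<le> C * \<rho> ^ n"
    and C: "C \<ge> 0" and \<rho>: "\<rho> \<ge> 0" and small: "\<delta> powr p * \<rho> < 1"
  shows "AE \<omega> in M. (\<lambda>n. D n \<omega>) \<in> O(\<lambda>n. \<delta> powi (- int n))"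
proof -
  define r where "r = \<delta> powr p * \<rho>"
  have r: "0 \<le> r" "r < 1" using \<rho> small by (auto simp: r_def)
  define S where "S n \<omega> = (\<delta> powr p) ^ n * D n \<omega> powr p" for n \<omega>
  have S0: "S n \<omega> \<ge> 0" for n \<omega> by (simp add: S_def)
  have Sint: "integrable M (S n)" for n
    unfolding S_def[abs_def] by (intro integrable_mult_right int)
  have [measurable]: "S n \<in> borel_measurable M" for n using Sint by auto
  have "(\<integral>\<^sup>+\<omega>. (\<Sum>n. ennreal (S n \<omega>)) \<partial>M) = (\<Sum>n. \<integral>\<^sup>+\<omega>. ennreal (S n \<omega>) \<partial>M)"
    by (rule nn_integral_suminf) simp
  also have "\<dots> \<le> (\<Sum>n. ennreal (C * r ^ n))"
  proof (intro suminf_le)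
    fix n
    have "(\<integral>\<^sup>+\<omega>. ennreal (S n \<omega>) \<partial>M) = ennreal (expectation (S n))"
      using Sint S0 by (intro nn_integral_eq_integral) auto
    also have "expectation (S n) \<le> (\<delta> powr p) ^ n * (C * \<rho> ^ n)"
      unfolding S_def using bound[of n] by (simp add: mult_left_mono)
    then have "ennreal (expectation (S n)) \<le> ennreal (C * r ^ n)"
      by (intro ennreal_leI) (simp add: r_def power_mult_distrib mult_ac)
    finally show "(\<integral>\<^sup>+\<omega>. ennreal (S n \<omega>) \<partial>M) \<le> ennreal (C * r ^ n)" .
  qed auto
  also have "\<dots> = ennreal (\<Sum>n. C * r ^ n)"
    using r C by (intro suminf_ennreal2 summable_mult summable_geometric) auto
  also have "\<dots> < \<infinity>" by simp
  finally have "AE \<omega> in M. (\<Sum>n. ennreal (S n \<omega>)) \<noteq> \<infinity>"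
    by (intro nn_integral_PInf_AE) auto
  then show ?thesis
  proof eventually_elim
    case (elim \<omega>)
    then have "summable (\<lambda>n. S n \<omega>)"
      using S0 by (intro summable_suminf_not_top) auto
    then have "Bseq (\<lambda>n. S n \<omega>)"
      by (intro convergent_imp_Bseq) (auto dest: summable_LIMSEQ_zero simp: convergent_def)
    then obtain B where B: "B > 0" "\<And>n. S n \<omega> \<le> B"
      using S0 by (auto simp: Bseq_def)
    show ?case
    proof (rule bigoI[where c = "B powr (1 / p)"], rule always_eventually, rule allI)
      fix n
      have "S n \<omega> = (\<delta> ^ n * D n \<omega>) powr p"
        using \<delta> D0[of n \<omega>] by (simp add: S_def powr_mult powr_powr powr_realpow[symmetric] mult.commute)
      then have "((\<delta> ^ n * D n \<omega>) powr p) powr (1 / p) \<le> B powr (1 / p)"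
        using B(2)[of n] p S0[of n \<omega>] by (intro powr_mono2) auto
      then have "\<delta> ^ n * D n \<omega> \<le> B powr (1 / p)"
        using p \<delta> D0[of n \<omega>] by (simp add: powr_powr)
      then show "norm (D n \<omega>) \<le> B powr (1 / p) * norm (\<delta> powi (- int n))"
        using \<delta> D0[of n \<omega>] by (simp add: power_int_minus field_simps)
    qed
  qed
qed

theorem mainTheorem3:
  fixes \<alpha> \<beta> b lam q H :: real
    and \<pi>0 \<pi>0' h0 :: "real \<Rightarrow> real"
    and M :: "'a measure"
    and X Y W G :: "nat \<Rightarrow> 'a \<Rightarrow> real"
  assumes "\<alpha> > 0" and "\<beta> > 0" and "b > 0" and "lam > 0" and "q = \<alpha> + \<beta>"
    and "\<pi>0 = gamma_density lam q"
    and "halfline_prob_density \<pi>0'"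
    and "h0 = (\<lambda>x. \<pi>0' x / \<pi>0 x)"
    and "\<exists>L. L-lipschitz_on {0<..} h0"
    and "H > 0" and "\<And>x. x > 0 \<Longrightarrow> h0 x \<ge> H"
    and "hidden_markov_model M \<alpha> \<beta> b \<pi>0' X Y W G"
  shows
    "(\<forall>n\<ge>1. \<forall>y. (\<forall>j\<in>{1..n}. y j > 0) \<longrightarrow>
        (let lam_n = b powi (- int n) * lam + (\<Sum>j=1..n. b powi (int j - int n) * y j)
         in filter_dist \<alpha> \<beta> b \<pi>0 \<pi>0' y n
              \<le> sqrt (2 * q) * lip_const {0<..} h0 / (2 * H) * inverse (b ^ n * lam_n)))
     \<and>
     (\<forall>\<delta>. 0 < \<delta> \<and> \<delta> < prob_space.expectation M (\<lambda>\<omega>. W 1 \<omega> powr \<beta>) powr (- 1 / \<beta>) \<longrightarrow>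
        (AE \<omega> in M. (\<lambda>n. filter_dist \<alpha> \<beta> b \<pi>0 \<pi>0' (\<lambda>j. Y j \<omega>) n) \<in> O(\<lambda>n. \<delta> powi (- int n))))
     \<and>
     (\<forall>p. 0 < p \<and> p < \<beta> \<longrightarrow>
        (let \<rho> = prob_space.expectation M (\<lambda>\<omega>. W 1 \<omega> powr p)
         in \<rho> = Beta (\<alpha> + p) \<beta> / Beta \<alpha> \<beta> \<and>
            (\<forall>n. integrable M (\<lambda>\<omega>. filter_dist \<alpha> \<beta> b \<pi>0 \<pi>0' (\<lambda>j. Y j \<omega>) n powr p)) \<and>
            (\<lambda>n. prob_space.expectation M
               (\<lambda>\<omega>. filter_dist \<alpha> \<beta> b \<pi>0 \<pi>0' (\<lambda>j. Y j \<omega>) n powr p)) \<in> O(\<lambda>n. \<rho> ^ n)))"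
proof -
  interpret hidden_markov_model M \<alpha> \<beta> b \<pi>0' X Y W G by (rule assms(12))
  note ab = assms(1-4)
  have q: "q > 0" using assms by simp
  define L where "L = lip_const {0<..} h0"
  have L: "L-lipschitz_on {0<..} h0"
    using assms(9) lip_const_lipschitz_on unfolding L_def by blast
  have K: "L / H \<ge> 0" using lipschitz_on_nonneg[OF L] assms(10) by simp
  have tilt': "gamma_tilt lam (\<alpha> + \<beta>) (L / H) \<pi>0'"
    using gamma_tilt_of_lipschitz_ratio[OF assms(4) q assms(7)] L assms(5,6,8,10,11) by simp
  \<comment> \<open>The reference density is its own reweighting by the constant 1.\<close>
  have tilt: "gamma_tilt lam (\<alpha> + \<beta>) 0 \<pi>0"
    unfolding gamma_tilt_def using has_bochner_integral_gamma_density[OF assms(4) q] assms(5,6)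
    by (intro exI[of _ "\<lambda>_. 1"] exI[of _ 1]) (auto simp: has_bochner_integral_iff lipschitz_on_def)
  have m: "(\<lambda>x. indicator {0<..} x * \<pi>0 x) \<in> borel_measurable borel"
    "(\<lambda>x. indicator {0<..} x * \<pi>0' x) \<in> borel_measurable borel"
    using assms(6,7) by (simp_all add: halfline_prob_density_def set_borel_measurable_def)
  note moments = filter_dist_moment_bound[OF ab K tilt tilt' m]
  have \<rho>: "expectation (\<lambda>\<omega>. W 1 \<omega> powr p) = Beta (\<alpha> + p) \<beta> / Beta \<alpha> \<beta>"
    "Beta (\<alpha> + p) \<beta> / Beta \<alpha> \<beta> > 0" if "p > 0" for p
    using signal_noise_moment(2)[OF assms(1,2) that, of 1] assms(1,2) that
    by (simp_all add: Beta_real_pos)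
  show ?thesis
  proof (intro conjI allI impI)
    fix n :: nat and y :: "nat \<Rightarrow> real"
    assume y: "\<forall>j\<in>{1..n}. y j > 0"
    define R where "R = lam + (\<Sum>j=1..n. b ^ j * y j)"
    define lam_n where "lam_n = b powi (- int n) * lam + (\<Sum>j=1..n. b powi (int j - int n) * y j)"
    have "b ^ n * b powi (int j - int n) = b ^ j" for j
      using assms(3) by (simp add: power_int_diff)
    then have R_eq: "b ^ n * lam_n = R"
      using assms(3) by (simp add: lam_n_def R_def distrib_left sum_distrib_left power_int_minus
          flip: mult.assoc)
    have "(\<Sum>j=1..n. b ^ j * y j) \<ge> 0"
      using y assms(3) by (intro sum_nonneg) (simp add: less_imp_le)
    then have R: "R > 0" using assms(4) by (simp add: R_def)
    have "filter_dist \<alpha> \<beta> b \<pi>0 \<pi>0' y n \<le> L / H * sqrt q / (2 * R)"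
      using filter_dist_le[OF ab tilt tilt' y] assms(5) by (simp add: R_def)
    \<comment> \<open>The variance argument yields \<open>sqrt q\<close>, which is relaxed to the
      claimed \<open>sqrt (2 * q)\<close>.\<close>
    also have "\<dots> \<le> L / H * sqrt (2 * q) / (2 * R)"
      using K R q by (intro divide_right_mono mult_left_mono) auto
    also have "\<dots> = sqrt (2 * q) * L / (2 * H) * inverse R" by (simp add: field_simps)
    finally show "let lam_n = b powi (- int n) * lam + (\<Sum>j=1..n. b powi (int j - int n) * y j)
         in filter_dist \<alpha> \<beta> b \<pi>0 \<pi>0' y n
              \<le> sqrt (2 * q) * lip_const {0<..} h0 / (2 * H) * inverse (b ^ n * lam_n)"
      unfolding Let_def lam_n_def[symmetric] R_eq L_def .
  next
    fix \<delta> :: real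
    assume \<delta>: "0 < \<delta> \<and> \<delta> < expectation (\<lambda>\<omega>. W 1 \<omega> powr \<beta>) powr (- 1 / \<beta>)"
    \<comment> \<open>With this exponent the square of \<open>W 1 \<omega> powr p\<close> is
      \<open>W 1 \<omega> powr \<beta>\<close>, so \<open>r\<^sup>2 \<le> E\<close> by nonnegativity
      of the variance. Raising the hypothesis on \<delta> to the power \<open>p\<close> gives
      \<open>\<delta> powr p < E powr (- (1 / 2))\<close>, and the two combine to
      \<open>\<delta> powr p * r < 1\<close>.\<close>
    define p where "p = \<beta> / 2"
    have p: "0 < p" "p < \<beta>" using assms(2) by (auto simp: p_def)
    define E where "E = expectation (\<lambda>\<omega>. W 1 \<omega> powr \<beta>)"
    define r where "r = expectation (\<lambda>\<omega>. W 1 \<omega> powr p)"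
    have r: "r = Beta (\<alpha> + p) \<beta> / Beta \<alpha> \<beta>" "r > 0" and E: "E > 0"
      unfolding r_def E_def using \<rho>[OF p(1)] \<rho>[OF assms(2)] by simp_all
    have "(W 1 \<omega> powr p)\<^sup>2 = W 1 \<omega> powr \<beta>" for \<omega>
      by (simp add: p_def power2_eq_square flip: powr_add)
    then have "r\<^sup>2 \<le> E"
      using expectation_sq_le[of "\<lambda>\<omega>. W 1 \<omega> powr p"] signal_noise_moment(1)[OF assms(1,2), of _ 1]
        p(1) assms(2) by (simp add: r_def E_def)
    then have "r \<le> E powr (1 / 2)"
      using real_le_rsqrt by (simp add: powr_half_sqrt E less_imp_le)
    moreover have "\<delta> powr p < E powr (- (1 / 2))"
      using powr_less_mono2[OF p(1), of \<delta> "E powr (- 1 / \<beta>)"] \<delta> assms(2)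
      by (simp add: powr_powr p_def E_def)
    ultimately have "\<delta> powr p * r < E powr (- (1 / 2)) * E powr (1 / 2)"
      using r E \<delta> by (intro mult_less_le_imp_less) auto
    also have "\<dots> = 1" using E by (simp flip: powr_add)
    finally have small: "\<delta> powr p * r < 1" .
    obtain C where C: "C \<ge> 0" "\<And>n. expectation (\<lambda>\<omega>. filter_dist \<alpha> \<beta> b \<pi>0 \<pi>0' (\<lambda>j. Y j \<omega>) n powr p) \<le> C * r ^ n"
      using moments(2)[OF p] unfolding r(1) by blast
    show "AE \<omega> in M. (\<lambda>n. filter_dist \<alpha> \<beta> b \<pi>0 \<pi>0' (\<lambda>j. Y j \<omega>) n) \<in> O(\<lambda>n. \<delta> powi (- int n))"
    proof (rule AE_bigo_of_geometric_moments[OF _ p(1) _ moments(1)[OF p] C(2) C(1) _ small])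
      show "0 \<le> filter_dist \<alpha> \<beta> b \<pi>0 \<pi>0' (\<lambda>j. Y j \<omega>) n" for n \<omega>
        by (simp add: filter_dist_eq[OF ab tilt tilt'])
    qed (use \<delta> r in auto)
  next
    fix p :: real
    assume p: "0 < p \<and> p < \<beta>"
    define r where "r = Beta (\<alpha> + p) \<beta> / Beta \<alpha> \<beta>"
    have r: "r > 0" using \<rho>(2) p by (simp add: r_def)
    obtain C where C: "\<And>n. expectation (\<lambda>\<omega>. filter_dist \<alpha> \<beta> b \<pi>0 \<pi>0' (\<lambda>j. Y j \<omega>) n powr p) \<le> C * r ^ n"
      using moments(2)[of p] p unfolding r_def by blast
    have "(\<lambda>n. expectation (\<lambda>\<omega>. filter_dist \<alpha> \<beta> b \<pi>0 \<pi>0' (\<lambda>j. Y j \<omega>) n powr p)) \<in> O(\<lambda>n. r ^ n)"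
      using C r by (intro bigoI[where c = C] always_eventually) (simp add: abs_of_nonneg)
    moreover have "integrable M (\<lambda>\<omega>. filter_dist \<alpha> \<beta> b \<pi>0 \<pi>0' (\<lambda>j. Y j \<omega>) n powr p)" for n
      using moments(1)[of p n] p by blast
    ultimately show "let \<rho> = expectation (\<lambda>\<omega>. W 1 \<omega> powr p)
         in \<rho> = Beta (\<alpha> + p) \<beta> / Beta \<alpha> \<beta> \<and>
            (\<forall>n. integrable M (\<lambda>\<omega>. filter_dist \<alpha> \<beta> b \<pi>0 \<pi>0' (\<lambda>j. Y j \<omega>) n powr p)) \<and>
            (\<lambda>n. expectation
               (\<lambda>\<omega>. filter_dist \<alpha> \<beta> b \<pi>0 \<pi>0' (\<lambda>j. Y j \<omega>) n powr p)) \<in> O(\<lambda>n. \<rho> ^ n)"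
      using \<rho>(1)[of p] p by (simp add: Let_def r_def)
  qed
qed

end
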